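(* Suppose Assumptions 1--4 of the context hold. Then there exists a state-dependent stationary policy (for each $\varepsilon>0$ a map $\boldsymbol\pi_\varepsilon:\mathcal C\to[0,q_{\max}]^m$) that is asymptotically optimal, as $\varepsilon\to0$, in terms of minimizing the wall clock time to reach error tolerance $\varepsilon$; that is, $$\lim_{\varepsilon\to0}\frac{\mathbb E\big[T_\varepsilon^{\boldsymbol\pi_\varepsilon}\big]}{\mathbb E\big[T_\varepsilon^{*}\big]}=1,$$ where $T_\varepsilon^{\boldsymbol\pi}$ is the wall clock time to reach tolerance $\varepsilon$ under policy $\boldsymbol\pi$ and $T_\varepsilon^*$ is the optimal wall clock time.
   Context: Setting. There are $m$ clients, a finite set $\mathcal C$ of network states, a bound $q_{\max}>0$, and a fixed number $\tau$ of local computations per round. A federated learning (FL) algorithm runs in rounds $n=1,2,\dots$; in round $n$ the clients use a vector of compression parameters $\boldsymbol q^{n}\in[0,q_{\max}]^m$, the network state is $c^{n}\in\mathcal C$, and the round has duration $d(\tau,\boldsymbol q^{n},c^{n})>0$. Assumption 1. For the given FL algorithm there exist a norm $\|\cdot\|$ on $\mathbb R^m$ and, for every $\varepsilon>0$, a strictly increasing, continuous, bounded function $h_\varepsilon:[0,q_{\max}]\to\mathbb R^+$ such that, with $\boldsymbol h_\varepsilon(\boldsymbol q)=(h_\varepsilon(q_1),\dots,h_\varepsilon(q_m))$, given any sequence $(\boldsymbol q^{n})_n$ of compression parameters the algorithm has reached error tolerance $\varepsilon$ by round $r$ if and only if $r>\frac1r\sum_{n=1}^r\|\boldsymbol h_\varepsilon(\boldsymbol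 q^{n})\|$. $\boldsymbol h_\varepsilon^{-1}$ denotes the (coordinatewise) inverse of $\boldsymbol h_\varepsilon$. Assumption 2. For any sequence of compression parameters, the minimum number of rounds $r_\varepsilon$ needed to reach error tolerance $\varepsilon$ satisfies $r_\varepsilon=\Theta(1/\mathrm{poly}(\varepsilon))$ as $\varepsilon\to0$, where $\mathrm{poly}(\varepsilon)$ is a polynomial in $\varepsilon$ (vanishing at $0$, so that the number of rounds grows as $\varepsilon\to0$). Assumption 3. For each network state $c$ and $\tau$, the map $\boldsymbol r\mapsto d(\tau,\boldsymbol h_\varepsilon^{-1}(\boldsymbol r),c)$ is bounded, convex in $\boldsymbol r$, and decreasing in every coordinate of $\boldsymbol r$. Assumption 4. The sequence of network states $(C^{n})_n$ is an irreducible aperiodic stationary Markov chain on the finite set $\mathcal C$ with invariant distribution $\mu$. Wall clock time. For a sequence $(\boldsymbol q^n)_n$ whose minimum number of rounds to reach tolerance $\varepsilon$ is $r_\varepsilon$, the wall clock time is $\sum_{n=1}^{r_\varepsilon}d(\tau,\boldsymbol q^n,c^n)$. A state-dependent stationary policy $\boldsymbol\pi:\mathcal C\to[0,q_{\max}]^m$ uses $\boldsymbol q^n=\boldsymbol\pi(C^n)$; its number of rounds is $R_\varepsilon^{\boldsymbol\pi}$ and its wall clock time is $T_\varepsilon^{\boldsymbol\pi}=\sum_{n=1}^{R_\varepsilon^{\boldsymbol\pi}}d(\tau,\boldsymbol\pi(C^n),C^n)$. $T_\varepsilon^*$ is the random wall clock time obtained when the optimal compression-parameter sequence for the realized network state sequence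 $(C^n)_n$ is used, i.e. the infimum of the wall clock time over all sequences $(\boldsymbol q^n)_n$ in $[0,q_{\max}]^m$ (which may depend on the whole state sequence). *)

theory Defs
  imports
    "HOL-Probability.Probability"
    "HOL-Library.Landau_Symbols"
    "HOL-Computational_Algebra.Polynomial"
begin

definition is_norm :: "('v::real_vector \<Rightarrow> real) \<Rightarrow> bool" where
  "is_norm N \<longleftrightarrow>
     (\<forall>x. 0 \<le> N x) \<and> (\<forall>x. N x = 0 \<longleftrightarrow> x = 0) \<and>
     (\<forall>a x. N (a *\<^sub>R x) = \<bar>a\<bar> * N x) \<and> (\<forall>x y. N (x + y) \<le> N x + N y)"

definition vec_apply :: "(real \<Rightarrow> real) \<Rightarrow> real ^ 'm \<Rightarrow> real ^ 'm" where
  "vec_apply f x = (\<chi> i. f (x $ i))"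

definition vecs_in :: "real set \<Rightarrow> (real ^ 'm) set" where
  "vecs_in S = {x. \<forall>i. x $ i \<in> S}"

text \<open>Rounds are numbered from 1; entry 0 of a sequence is never used.\<close>

definition param_seqs :: "real \<Rightarrow> (nat \<Rightarrow> real ^ 'm) set" where
  "param_seqs qmax = {q. \<forall>n\<ge>1. q n \<in> vecs_in {0..qmax}}"

text \<open>\<open>reached \<epsilon> q r\<close>: run with compression parameters \<open>q\<close>, the algorithm has reached
  error tolerance \<open>\<epsilon>\<close> by round \<open>r\<close>.\<close>

definition min_rounds ::
    "(real \<Rightarrow> (nat \<Rightarrow> real ^ 'm) \<Rightarrow> nat \<Rightarrow> bool) \<Rightarrow> real \<Rightarrow> (nat \<Rightarrow> real ^ 'm) \<Rightarrow> nat" where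
  "min_rounds reached \<epsilon> q = (LEAST r. 1 \<le> r \<and> reached \<epsilon> q r)"

definition wall_clock ::
    "(real \<Rightarrow> (nat \<Rightarrow> real ^ 'm) \<Rightarrow> nat \<Rightarrow> bool) \<Rightarrow> (real ^ 'm \<Rightarrow> 'c \<Rightarrow> real) \<Rightarrow> real \<Rightarrow>
      (nat \<Rightarrow> real ^ 'm) \<Rightarrow> (nat \<Rightarrow> 'c) \<Rightarrow> real" where
  "wall_clock reached dur \<epsilon> q c = (\<Sum>n=1..min_rounds reached \<epsilon> q. dur (q n) (c n))"

definition policy_time ::
    "(real \<Rightarrow> (nat \<Rightarrow> real ^ 'm) \<Rightarrow> nat \<Rightarrow> bool) \<Rightarrow> (real ^ 'm \<Rightarrow> 'c \<Rightarrow> real) \<Rightarrow> real \<Rightarrow>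
      ('c \<Rightarrow> real ^ 'm) \<Rightarrow> (nat \<Rightarrow> 'c) \<Rightarrow> real" where
  "policy_time reached dur \<epsilon> \<pi> c = wall_clock reached dur \<epsilon> (\<lambda>n. \<pi> (c n)) c"

definition opt_time ::
    "(real \<Rightarrow> (nat \<Rightarrow> real ^ 'm) \<Rightarrow> nat \<Rightarrow> bool) \<Rightarrow> (real ^ 'm \<Rightarrow> 'c \<Rightarrow> real) \<Rightarrow> real \<Rightarrow> real \<Rightarrow>
      (nat \<Rightarrow> 'c) \<Rightarrow> real" where
  "opt_time reached dur qmax \<epsilon> c = (INF q\<in>param_seqs qmax. wall_clock reached dur \<epsilon> q c)"

primrec step_kernel :: "('c \<Rightarrow> 'c pmf) \<Rightarrow> nat \<Rightarrow> 'c \<Rightarrow> 'c pmf" where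
  "step_kernel K 0 x = return_pmf x"
| "step_kernel K (Suc n) x = bind_pmf (K x) (step_kernel K n)"

definition irreducible_kernel :: "('c \<Rightarrow> 'c pmf) \<Rightarrow> bool" where
  "irreducible_kernel K \<longleftrightarrow> (\<forall>x y. \<exists>n. pmf (step_kernel K n x) y > 0)"

definition aperiodic_kernel :: "('c \<Rightarrow> 'c pmf) \<Rightarrow> bool" where
  "aperiodic_kernel K \<longleftrightarrow> (\<forall>x. Gcd {n. n \<ge> 1 \<and> pmf (step_kernel K n x) x > 0} = 1)"

definition markov_chain ::
    "'w measure \<Rightarrow> (nat \<Rightarrow> 'w \<Rightarrow> 'c) \<Rightarrow> ('c \<Rightarrow> 'c pmf) \<Rightarrow> bool" where
  "markov_chain M C K \<longleftrightarrow>
     prob_space M \<and>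
     (\<forall>n\<ge>1. C n \<in> M \<rightarrow>\<^sub>M count_space UNIV) \<and>
     (\<forall>n\<ge>1. \<forall>s y. \<P>(\<omega> in M. \<forall>k\<in>{1..n}. C k \<omega> = s k) > 0 \<longrightarrow>
        \<P>(\<omega> in M. C (Suc n) \<omega> = y \<bar> \<forall>k\<in>{1..n}. C k \<omega> = s k) = pmf (K (s n)) y)"

text \<open>For a time-homogeneous chain, stationarity of the process amounts to the initial state
  being distributed according to an invariant distribution.\<close>

definition stationary_markov_chain ::
    "'w measure \<Rightarrow> (nat \<Rightarrow> 'w \<Rightarrow> 'c) \<Rightarrow> ('c \<Rightarrow> 'c pmf) \<Rightarrow> 'c pmf \<Rightarrow> bool" where
  "stationary_markov_chain M C K \<mu> \<longleftrightarrow>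
     markov_chain M C K \<and> bind_pmf \<mu> K = \<mu> \<and>
     distr M (count_space UNIV) (C 1) = measure_pmf \<mu>"

end

theory Submission
  imports Defs
begin

text \<open>Write \<open>x = h(q)\<close>. Heuristically a stationary policy \<open>y\<close> needs about \<open>E N(y)\<close> rounds of mean
  duration \<open>E d(y)\<close>, expectations being taken under \<open>\<mu>\<close>, so the target value is
  \<open>V = inf E N(y) E d(y)\<close> over stationary policies. If the visit counts of the chain at the
  stopping round are close to their means, then averaging the parameters of an arbitrary
  schedule over the visits to each state (Jensen) shows that it takes at least \<open>(1 - \<delta>)\<^sup>2 V\<close>, while a
  near-minimiser of \<open>V\<close> takes at most \<open>(1 + \<delta>)\<^sup>2 V\<close>. Since \<open>d\<close> lies between two positive constants that
  do not depend on \<open>\<epsilon>\<close>, only schedules stopping within a constant factor of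
  \<open>inf N\<close> rounds matter for the lower bound; this infimum tends to infinity by Assumption 2
  applied to the zero parameters. The weak law for visit counts comes from a second-moment
  bound obtained by solving the Poisson equation of the chain.\<close>

subsection \<open>Finite irreducible kernels\<close>

text \<open>The optimal schedule may look at the whole state sequence and changes with
  \<open>\<epsilon>\<close>, so a limit theorem for one fixed process does not apply to it. The
  lower bound is therefore pathwise: on a single event of probability at least
  \<open>1 - \<delta>\<close> it holds for all schedules at once, whatever round they stop in. For
  the same reason every threshold on the number of rounds depends only on \<open>\<delta>\<close>,
  the chain and the bounds on the durations, never on \<open>\<epsilon>\<close> or on the policy.
  Those duration bounds are free of \<open>\<epsilon>\<close> because \<open>h \<epsilon>\<close>
  maps the parameter cube bijectively onto its image: passing to \<open>x = h(q)\<close> relabels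
  the arguments of \<open>d\<close> but leaves its range unchanged. The value is a product because a
  schedule may stop in round \<open>r\<close> once the average of its \<open>N(x n)\<close> over the
  first \<open>r\<close> rounds drops below \<open>r\<close>. With state frequencies
  \<open>\<mu>\<close> this happens near \<open>r = E N(y)\<close>, and each of these rounds lasts
  \<open>E d(y)\<close> on average.\<close>

lemma pmf_bind_finite:
  fixes \<mu> :: "'c::finite pmf"
  shows "pmf (bind_pmf \<mu> K) y = (\<Sum>x\<in>UNIV. pmf \<mu> x * pmf (K x) y)"
  unfolding pmf_bind by (subst integral_measure_pmf_real[of UNIV]) (auto simp: mult.commute)

lemma sum_pmf_UNIV: "(\<Sum>x\<in>UNIV. pmf (p :: 'c::finite pmf) x) = 1"
  by (rule sum_pmf_eq_1) auto

lemma invariant_step_kernel: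
  assumes "bind_pmf \<mu> K = \<mu>"
  shows "bind_pmf \<mu> (step_kernel K n) = \<mu>"
proof (induction n)
  case 0
  then show ?case by (simp add: bind_return_pmf')
next
  case (Suc n)
  then show ?case using assms by (simp flip: bind_assoc_pmf)
qed

text \<open>Some state carries mass, \<open>y\<close> is reached from it in \<open>n\<close> steps,
  and \<open>\<mu>\<close> is invariant under the \<open>n\<close>-step kernel.\<close>

lemma irreducible_invariant_pos:
  assumes inv: "bind_pmf \<mu> K = \<mu>" and irred: "irreducible_kernel K"
  shows "pmf \<mu> y > 0"
proof -
  obtain x where x: "x \<in> set_pmf \<mu>"
    using set_pmf_not_empty[of \<mu>] by blast
  obtain n where "pmf (step_kernel K n x) y > 0"
    using irred unfolding irreducible_kernel_def by blast
  hence "y \<in> set_pmf (step_kernel K n x)"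
    by (simp add: set_pmf_iff)
  hence "y \<in> set_pmf (bind_pmf \<mu> (step_kernel K n))"
    using x by auto
  thus ?thesis
    unfolding invariant_step_kernel[OF inv] by (simp add: pmf_positive)
qed

text \<open>Maximum principle: where \<open>g\<close> attains its maximum, the maximum is an average
  of values not exceeding it, so all successors attain it too. Irreducibility spreads this to every
  state.\<close>

lemma harmonic_constant:
  fixes g :: "'c::finite \<Rightarrow> real"
  assumes irred: "irreducible_kernel K"
    and harm: "\<And>x. (\<Sum>y\<in>UNIV. pmf (K x) y * g y) = g x"
  shows "g x = g y"
proof -
  define m where "m = Max (range g)"
  have le: "g z \<le> m" for z
    unfolding m_def by (rule Max_ge) auto
  have "m \<in> range g"
    unfolding m_def by (rule Max_in) auto
  then obtain x0 where x0: "g x0 = m" by auto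
  have step: "g z = m" if "g w = m" "pmf (K w) z > 0" for w z
  proof -
    have "(\<Sum>y\<in>UNIV. pmf (K w) y * (m - g y)) = 0"
      using harm[of w] that by (simp add: algebra_simps sum_subtractf sum_pmf_UNIV flip: sum_distrib_left)
    hence "pmf (K w) z * (m - g z) = 0"
      using le by (subst (asm) sum_nonneg_eq_0_iff) auto
    thus ?thesis using that by simp
  qed
  have reach: "g z = m" if "g w = m" "pmf (step_kernel K n w) z > 0" for n w z
    using that
  proof (induction n arbitrary: w)
    case 0
    then show ?case by (auto simp: indicator_def split: if_splits)
  next
    case (Suc n)
    have "z \<in> set_pmf (bind_pmf (K w) (step_kernel K n))"
      using Suc.prems(2) by (subst set_pmf_iff) simp
    then obtain v where "v \<in> set_pmf (K w)" "z \<in> set_pmf (step_kernel K n v)"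
      by auto
    thus ?case using Suc.IH[of v] step[of w v] Suc.prems
      by (simp add: pmf_positive)
  qed
  have "g z = m" for z
    using reach x0 irred unfolding irreducible_kernel_def by blast
  thus ?thesis by simp
qed

text \<open>Adding the rank-one map \<open>g \<mapsto> \<mu>(g) 1\<close> makes \<open>I - K\<close> injective, hence surjective;
  applying \<open>\<mu>\<close> shows that the correction vanishes when \<open>\<mu>(f) = 0\<close>.\<close>

lemma poisson_equation:
  fixes f :: "'c::finite \<Rightarrow> real"
  assumes inv: "bind_pmf \<mu> K = \<mu>" and irred: "irreducible_kernel K"
    and f: "(\<Sum>x\<in>UNIV. pmf \<mu> x * f x) = 0"
  obtains g where "\<And>x. g x - (\<Sum>y\<in>UNIV. pmf (K x) y * g y) = f x"
proof -
  define L :: "real ^ 'c \<Rightarrow> real ^ 'c" where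
    "L g = (\<chi> x. g $ x - (\<Sum>y\<in>UNIV. pmf (K x) y * g $ y) + (\<Sum>y\<in>UNIV. pmf \<mu> y * g $ y))" for g
  have lin: "linear L"
    by (rule linearI)
       (auto simp: L_def vec_eq_iff algebra_simps sum.distrib sum_distrib_left)
  \<comment> \<open>Invariance cancels the first two terms of \<open>L\<close>. This identity serves
    twice: it gives kernel elements mean zero, and it shows that the solution for a centred
    \<open>f\<close> has mean zero.\<close>
  have \<mu>L: "(\<Sum>x\<in>UNIV. pmf \<mu> x * L g $ x) = (\<Sum>y\<in>UNIV. pmf \<mu> y * g $ y)" for g
  proof -
    have "(\<Sum>x\<in>UNIV. pmf \<mu> x * (\<Sum>y\<in>UNIV. pmf (K x) y * g $ y))
        = (\<Sum>y\<in>UNIV. (\<Sum>x\<in>UNIV. pmf \<mu> x * pmf (K x) y) * g $ y)"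
      unfolding sum_distrib_left sum_distrib_right
      by (subst sum.swap) (simp add: mult.assoc)
    also have "\<dots> = (\<Sum>y\<in>UNIV. pmf \<mu> y * g $ y)"
      unfolding pmf_bind_finite[symmetric] inv ..
    finally have "(\<Sum>x\<in>UNIV. pmf \<mu> x * (\<Sum>y\<in>UNIV. pmf (K x) y * g $ y)) = (\<Sum>y\<in>UNIV. pmf \<mu> y * g $ y)" .
    moreover have "(\<Sum>x\<in>UNIV. pmf \<mu> x * c) = c" for c
      by (simp add: sum_pmf_UNIV flip: sum_distrib_right)
    ultimately show ?thesis
      by (simp add: L_def distrib_left right_diff_distrib sum.distrib sum_subtractf)
  qed
  have "inj L"
  proof (rule linear_injective_0[OF lin, THEN iffD2], safe)
    fix g assume g: "L g = 0"
    hence m0: "(\<Sum>y\<in>UNIV. pmf \<mu> y * g $ y) = 0"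
      using \<mu>L[of g] by simp
    have "(\<Sum>y\<in>UNIV. pmf (K x) y * g $ y) = g $ x" for x
      using arg_cong[OF g, of "\<lambda>v. v $ x"] m0 by (simp add: L_def)
    hence const: "g $ x = g $ y" for x y
      using harmonic_constant[OF irred, of "\<lambda>x. g $ x"] by blast
    have "g $ x = 0" for x
    proof -
      have "(\<Sum>y\<in>UNIV. pmf \<mu> y * g $ y) = (\<Sum>y\<in>UNIV. pmf \<mu> y * g $ x)"
        by (intro sum.cong refl) (metis const)
      thus ?thesis
        using m0 by (simp add: sum_pmf_UNIV flip: sum_distrib_right)
    qed
    thus "g = 0" by (simp add: vec_eq_iff)
  qed
  hence "surj L"
    using lin linear_injective_imp_surjective by blast
  then obtain g where g: "L g = (\<chi> x. f x)"
    by (metis surjD)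
  have "(\<Sum>y\<in>UNIV. pmf \<mu> y * g $ y) = 0"
    using \<mu>L[of g] f unfolding g by simp
  hence "g $ x - (\<Sum>y\<in>UNIV. pmf (K x) y * g $ y) = f x" for x
    using arg_cong[OF g, of "\<lambda>v. v $ x"] by (simp add: L_def)
  thus thesis by (rule that)
qed

subsection \<open>Visit counts of the chain\<close>

definition visits :: "(nat \<Rightarrow> 'c) \<Rightarrow> nat \<Rightarrow> 'c \<Rightarrow> real" where
  "visits s r c = (\<Sum>n=1..r. of_bool (s n = c))"

lemma visits_mono: "r \<le> r' \<Longrightarrow> visits s r c \<le> visits s r' c"
  unfolding visits_def by (rule sum_mono2) auto

lemma sum_visits:
  fixes s :: "nat \<Rightarrow> 'c::finite" and F :: "'c \<Rightarrow> real"
  shows "(\<Sum>n=1..r. F (s n)) = (\<Sum>c\<in>UNIV. visits s r c * F c)"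
proof -
  have "F (s n) = (\<Sum>c\<in>UNIV. of_bool (s n = c) * F c)" for n
    by simp
  thus ?thesis
    unfolding visits_def sum_distrib_right by (simp only: sum.swap[of _ "{1..r}"])
qed

lemma visits_cong: "(\<And>k. k \<in> {1..r} \<Longrightarrow> s k = t k) \<Longrightarrow> visits s r c = visits t r c"
  unfolding visits_def by (intro sum.cong refl) auto

section \<open>Functionals of a finite prefix of the chain\<close>

locale irreducible_chain = prob_space M for M :: "'w measure" +
  fixes C :: "nat \<Rightarrow> 'w \<Rightarrow> 'c::finite" and K :: "'c \<Rightarrow> 'c pmf" and \<mu> :: "'c pmf"
  assumes chain: "markov_chain M C K"
    and invariant: "bind_pmf \<mu> K = \<mu>"
    and irreducible: "irreducible_kernel K"
begin

definition path_event :: "nat \<Rightarrow> (nat \<Rightarrow> 'c) \<Rightarrow> 'w set" where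
  "path_event n s = {\<omega>\<in>space M. \<forall>k\<in>{1..n}. C k \<omega> = s k}"

lemma measurable_C: "n \<ge> 1 \<Longrightarrow> C n \<in> M \<rightarrow>\<^sub>M count_space UNIV"
  using chain unfolding markov_chain_def by blast

lemma path_event_sets [measurable]: "path_event n s \<in> sets M"
  unfolding path_event_def
proof (rule sets.sets_Collect_finite_All)
  fix k assume "k \<in> {1..n}"
  hence "C k -` {s k} \<inter> space M \<in> sets M"
    by (intro measurable_sets[OF measurable_C]) auto
  also have "C k -` {s k} \<inter> space M = {\<omega>\<in>space M. C k \<omega> = s k}" by auto
  finally show "{\<omega>\<in>space M. C k \<omega> = s k} \<in> sets M" .
qed simp

lemma finite_paths: "finite ({1..n::nat} \<rightarrow>\<^sub>E (UNIV :: 'c set))"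
  by (rule finite_PiE) auto

text \<open>With finitely many states a prefix takes finitely many values, so anything determined by
  it is a simple function. Measurability, integrability and expectations all reduce to finite sums,
  even when \<open>F\<close> is an infimum over uncountably many schedules.\<close>

lemma path_expansion:
  fixes F :: "(nat \<Rightarrow> 'c) \<Rightarrow> real"
  assumes F: "\<And>s t. (\<forall>k\<in>{1..n}. s k = t k) \<Longrightarrow> F s = F t" and \<omega>: "\<omega> \<in> space M"
  shows "F (\<lambda>k. C k \<omega>) = (\<Sum>s\<in>{1..n} \<rightarrow>\<^sub>E UNIV. F s * indicator (path_event n s) \<omega>)"
proof -
  define s0 where "s0 = restrict (\<lambda>k. C k \<omega>) {1..n}"
  have s0: "s0 \<in> {1..n} \<rightarrow>\<^sub>E UNIV"
    by (auto simp: s0_def)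
  have "\<omega> \<in> path_event n s \<longleftrightarrow> s = s0" if "s \<in> {1..n} \<rightarrow>\<^sub>E UNIV" for s
  proof
    assume "\<omega> \<in> path_event n s"
    thus "s = s0"
      by (intro PiE_ext[OF that s0]) (auto simp: path_event_def s0_def)
  qed (auto simp: path_event_def s0_def \<omega>)
  hence "(\<Sum>s\<in>{1..n} \<rightarrow>\<^sub>E UNIV. F s * indicator (path_event n s) \<omega>)
      = (\<Sum>s\<in>{1..n} \<rightarrow>\<^sub>E UNIV. if s = s0 then F s else 0)"
    by (intro sum.cong refl) (auto simp: indicator_def)
  also have "\<dots> = F s0"
    unfolding sum.delta[OF finite_paths] using s0 by simp
  also have "F s0 = F (\<lambda>k. C k \<omega>)"
    by (rule F) (simp add: s0_def)
  finally show ?thesis ..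
qed

lemma path_integrable:
  fixes F :: "(nat \<Rightarrow> 'c) \<Rightarrow> real"
  assumes "\<And>s t. (\<forall>k\<in>{1..n}. s k = t k) \<Longrightarrow> F s = F t"
  shows "integrable M (\<lambda>\<omega>. F (\<lambda>k. C k \<omega>))"
proof -
  have "integrable M (\<lambda>\<omega>. \<Sum>s\<in>{1..n} \<rightarrow>\<^sub>E UNIV. F s * indicator (path_event n s) \<omega>)"
    by (intro Bochner_Integration.integrable_sum integrable_mult_right integrable_real_indicator path_event_sets)
       (simp add: emeasure_eq_measure)
  thus ?thesis
    by (subst Bochner_Integration.integrable_cong[OF refl path_expansion[of n F, OF assms]]) auto
qed

lemma path_expectation:
  fixes F :: "(nat \<Rightarrow> 'c) \<Rightarrow> real"
  assumes "\<And>s t. (\<forall>k\<in>{1..n}. s k = t k) \<Longrightarrow> F s = F t"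
  shows "expectation (\<lambda>\<omega>. F (\<lambda>k. C k \<omega>)) = (\<Sum>s\<in>{1..n} \<rightarrow>\<^sub>E UNIV. F s * prob (path_event n s))"
proof -
  have "expectation (\<lambda>\<omega>. F (\<lambda>k. C k \<omega>))
      = expectation (\<lambda>\<omega>. \<Sum>s\<in>{1..n} \<rightarrow>\<^sub>E UNIV. F s * indicator (path_event n s) \<omega>)"
    by (intro Bochner_Integration.integral_cong refl path_expansion assms)
  also have "\<dots> = (\<Sum>s\<in>{1..n} \<rightarrow>\<^sub>E UNIV. expectation (\<lambda>\<omega>. F s * indicator (path_event n s) \<omega>))"
    by (intro Bochner_Integration.integral_sum integrable_mult_right integrable_real_indicator path_event_sets)
       (simp add: emeasure_eq_measure)
  also have "\<dots> = (\<Sum>s\<in>{1..n} \<rightarrow>\<^sub>E UNIV. F s * prob (path_event n s))"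
    by (intro sum.cong refl) simp
  finally show ?thesis .
qed

lemma path_measurable:
  assumes "\<And>s t. (\<forall>k\<in>{1..n}. s k = t k) \<Longrightarrow> P s = P t"
  shows "{\<omega>\<in>space M. P (\<lambda>k. C k \<omega>)} \<in> sets M"
proof -
  have "integrable M (\<lambda>\<omega>. of_bool (P (\<lambda>k. C k \<omega>)) :: real)"
    by (rule path_integrable[of n "\<lambda>s. of_bool (P s)"]) (intro arg_cong[where f = of_bool] assms)
  hence "(\<lambda>\<omega>. of_bool (P (\<lambda>k. C k \<omega>)) :: real) -` {1} \<inter> space M \<in> sets M"
    by (intro measurable_sets[OF borel_measurable_integrable]) auto
  also have "(\<lambda>\<omega>. of_bool (P (\<lambda>k. C k \<omega>)) :: real) -` {1} \<inter> space M = {\<omega>\<in>space M. P (\<lambda>k. C k \<omega>)}"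
    by auto
  finally show ?thesis .
qed

lemma path_event_Suc:
  assumes "n \<ge> 1"
  shows "prob (path_event (Suc n) s) = prob (path_event n s) * pmf (K (s n)) (s (Suc n))"
proof (cases "prob (path_event n s) > 0")
  case True
  hence "\<P>(\<omega> in M. C (Suc n) \<omega> = s (Suc n) \<bar> \<forall>k\<in>{1..n}. C k \<omega> = s k) = pmf (K (s n)) (s (Suc n))"
    using chain assms unfolding markov_chain_def path_event_def by blast
  moreover have "{\<omega>\<in>space M. C (Suc n) \<omega> = s (Suc n) \<and> (\<forall>k\<in>{1..n}. C k \<omega> = s k)} = path_event (Suc n) s"
    by (auto simp: path_event_def atLeastAtMostSuc_conv)
  ultimately show ?thesis
    unfolding cond_prob_def path_event_def[of n s, symmetric] using True
    by (simp add: field_simps)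
next
  \<comment> \<open>The Markov property says nothing after a null prefix, but then both sides
    vanish.\<close>
  case False
  hence "prob (path_event n s) = 0"
    by (simp add: zero_less_measure_iff)
  moreover have "prob (path_event (Suc n) s) \<le> prob (path_event n s)"
    by (intro finite_measure_mono path_event_sets) (auto simp: path_event_def)
  ultimately show ?thesis
    by (simp add: measure_le_0_iff)
qed

text \<open>The martingale difference property, tested against functions \<open>\<phi>\<close> of
  the past instead of being phrased by conditional expectations: given the prefix,
  \<open>g (C (Suc n))\<close> has mean \<open>K g (C n)\<close>.\<close>

lemma increment_orthogonal:
  fixes \<phi> :: "(nat \<Rightarrow> 'c) \<Rightarrow> real" and g :: "'c \<Rightarrow> real"
  assumes n: "n \<ge> 1" and \<phi>: "\<And>s t. (\<forall>k\<in>{1..n}. s k = t k) \<Longrightarrow> \<phi> s = \<phi> t"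
  shows "expectation (\<lambda>\<omega>. \<phi> (\<lambda>k. C k \<omega>) * (g (C (Suc n) \<omega>) - (\<Sum>y\<in>UNIV. pmf (K (C n \<omega>)) y * g y))) = 0"
proof -
  define F where "F s = \<phi> s * (g (s (Suc n)) - (\<Sum>y\<in>UNIV. pmf (K (s n)) y * g y))" for s
  have F: "F s = F t" if "\<forall>k\<in>{1..Suc n}. s k = t k" for s t
  proof -
    have "\<phi> s = \<phi> t" by (rule \<phi>) (use that in auto)
    thus ?thesis using that n by (simp add: F_def)
  qed
  \<comment> \<open>A prefix of length \<open>Suc n\<close> is split into one of length
    \<open>n\<close> and its last state; the sum over the last state alone is already zero.\<close>
  have eq: "{1..Suc n} = insert (Suc n) {1..n}" by auto
  have inj: "inj_on (\<lambda>(y, s). s(Suc n := y)) (UNIV \<times> ({1..n} \<rightarrow>\<^sub>E (UNIV :: 'c set)))"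
    by (rule inj_combinator) auto
  have zero: "(\<Sum>y\<in>UNIV. F (s(Suc n := y)) * prob (path_event (Suc n) (s(Suc n := y)))) = 0" for s
  proof -
    have [simp]: "\<phi> (s(Suc n := y)) = \<phi> s" for y
      by (rule \<phi>) auto
    have [simp]: "path_event n (s(Suc n := y)) = path_event n s" for y
      by (auto simp: path_event_def)
    define m where "m = (\<Sum>y\<in>UNIV. pmf (K (s n)) y * g y)"
    have "(\<Sum>y\<in>UNIV. F (s(Suc n := y)) * prob (path_event (Suc n) (s(Suc n := y))))
        = (\<Sum>y\<in>UNIV. \<phi> s * prob (path_event n s) * (pmf (K (s n)) y * g y - pmf (K (s n)) y * m))"
      using n by (intro sum.cong refl) (simp add: F_def path_event_Suc m_def algebra_simps)
    also have "\<dots> = \<phi> s * prob (path_event n s) * (m - (\<Sum>y\<in>UNIV. pmf (K (s n)) y * m))"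
      by (simp add: sum_subtractf m_def flip: sum_distrib_left)
    also have "\<dots> = 0"
      by (simp add: sum_pmf_UNIV flip: sum_distrib_right)
    finally show ?thesis .
  qed
  have "expectation (\<lambda>\<omega>. F (\<lambda>k. C k \<omega>)) = (\<Sum>s\<in>{1..Suc n} \<rightarrow>\<^sub>E UNIV. F s * prob (path_event (Suc n) s))"
    by (rule path_expectation) (rule F)
  also have "\<dots> = (\<Sum>(y, s)\<in>UNIV \<times> ({1..n} \<rightarrow>\<^sub>E UNIV).
                   F (s(Suc n := y)) * prob (path_event (Suc n) (s(Suc n := y))))"
    unfolding eq PiE_insert_eq by (subst sum.reindex[OF inj]) (simp add: case_prod_unfold)
  also have "\<dots> = 0"
    by (subst sum.cartesian_product[symmetric], subst sum.swap) (simp add: zero)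
  finally show ?thesis by (simp add: F_def)
qed

text \<open>The cross term vanishes by orthogonality, so each step adds at most the square of the
  bound \<open>2 * G\<close> on one increment: linear instead of quadratic growth.\<close>

lemma martingale_second_moment:
  fixes g :: "'c \<Rightarrow> real"
  assumes G: "\<And>x. \<bar>g x\<bar> \<le> G"
  defines "Z \<equiv> \<lambda>r (s :: nat \<Rightarrow> 'c). \<Sum>n=1..r. g (s (Suc n)) - (\<Sum>y\<in>UNIV. pmf (K (s n)) y * g y)"
  shows "expectation (\<lambda>\<omega>. (Z r (\<lambda>k. C k \<omega>))\<^sup>2) \<le> r * (2 * G)\<^sup>2"
proof (induction r)
  case 0
  then show ?case by (simp add: Z_def)
next
  case (Suc r)
  define D where "D s = g (s (Suc (Suc r))) - (\<Sum>y\<in>UNIV. pmf (K (s (Suc r))) y * g y)" for s :: "nat \<Rightarrow> 'c"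
  have Z: "Z r s = Z r t" if "\<forall>k\<in>{1..Suc r}. s k = t k" for s t
    unfolding Z_def using that by (intro sum.cong refl) auto
  have D: "D s = D t" if "\<forall>k\<in>{1..Suc (Suc r)}. s k = t k" for s t
    using that by (simp add: D_def)
  have D_bd: "\<bar>D s\<bar> \<le> 2 * G" for s
  proof -
    have "\<bar>\<Sum>y\<in>UNIV. pmf (K (s (Suc r))) y * g y\<bar> \<le> (\<Sum>y\<in>UNIV. pmf (K (s (Suc r))) y * G)"
      by (rule order.trans[OF sum_abs]) (auto intro!: sum_mono mult_left_mono G simp: abs_mult)
    also have "\<dots> = G" by (simp add: sum_pmf_UNIV flip: sum_distrib_right)
    finally show ?thesis using G[of "s (Suc (Suc r))"] unfolding D_def by linarith
  qed
  have int: "integrable M (\<lambda>\<omega>. H (\<lambda>k. C k \<omega>))" if "H \<in> {\<lambda>s. (Z r s)\<^sup>2, \<lambda>s. 2 * (Z r s * D s), \<lambda>s. (D s)\<^sup>2}" for H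
  proof (rule path_integrable[of "Suc (Suc r)"])
    fix s t :: "nat \<Rightarrow> 'c" assume st: "\<forall>k\<in>{1..Suc (Suc r)}. s k = t k"
    have "Z r s = Z r t" by (rule Z) (use st in auto)
    thus "H s = H t" using that D[OF st] by auto
  qed
  have int1: "integrable M (\<lambda>\<omega>. (Z r (\<lambda>k. C k \<omega>))\<^sup>2)"
    and int2: "integrable M (\<lambda>\<omega>. 2 * (Z r (\<lambda>k. C k \<omega>) * D (\<lambda>k. C k \<omega>)))"
    and int3: "integrable M (\<lambda>\<omega>. (D (\<lambda>k. C k \<omega>))\<^sup>2)"
    using int[of "\<lambda>s. (Z r s)\<^sup>2"] int[of "\<lambda>s. 2 * (Z r s * D s)"] int[of "\<lambda>s. (D s)\<^sup>2"]
    by simp_all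
  have "(Z (Suc r) s)\<^sup>2 = (Z r s)\<^sup>2 + 2 * (Z r s * D s) + (D s)\<^sup>2" for s
    by (simp add: Z_def D_def power2_sum)
  hence "expectation (\<lambda>\<omega>. (Z (Suc r) (\<lambda>k. C k \<omega>))\<^sup>2)
      = expectation (\<lambda>\<omega>. (Z r (\<lambda>k. C k \<omega>))\<^sup>2 + 2 * (Z r (\<lambda>k. C k \<omega>) * D (\<lambda>k. C k \<omega>)) + (D (\<lambda>k. C k \<omega>))\<^sup>2)"
    by simp
  also have "\<dots> = expectation (\<lambda>\<omega>. (Z r (\<lambda>k. C k \<omega>))\<^sup>2)
      + expectation (\<lambda>\<omega>. 2 * (Z r (\<lambda>k. C k \<omega>) * D (\<lambda>k. C k \<omega>))) + expectation (\<lambda>\<omega>. (D (\<lambda>k. C k \<omega>))\<^sup>2)"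
    by (simp only: Bochner_Integration.integral_add[OF Bochner_Integration.integrable_add[OF int1 int2] int3]
        Bochner_Integration.integral_add[OF int1 int2])
  also have "expectation (\<lambda>\<omega>. 2 * (Z r (\<lambda>k. C k \<omega>) * D (\<lambda>k. C k \<omega>))) = 0"
    using increment_orthogonal[of "Suc r" "Z r" g] Z by (simp add: D_def)
  also have "expectation (\<lambda>\<omega>. (D (\<lambda>k. C k \<omega>))\<^sup>2) \<le> (2 * G)\<^sup>2"
    by (intro integral_le_const int3 AE_I2) (metis D_bd power2_abs power_mono abs_ge_zero)
  finally show ?case using Suc.IH by (simp add: algebra_simps)
qed

text \<open>With the Poisson solution \<open>g\<close> for the centred indicator of
  \<open>c\<close>, the centred visit count is a martingale up to a bounded boundary term.\<close>

lemma visits_second_moment: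
  obtains A where "A > 0"
    "\<And>r c. r \<ge> 1 \<Longrightarrow> expectation (\<lambda>\<omega>. (visits (\<lambda>k. C k \<omega>) r c - r * pmf \<mu> c)\<^sup>2) \<le> A * r"
proof -
  have "\<exists>A. \<forall>r\<ge>1. expectation (\<lambda>\<omega>. (visits (\<lambda>k. C k \<omega>) r c - r * pmf \<mu> c)\<^sup>2) \<le> A * r" for c
  proof -
    define f :: "'c \<Rightarrow> real" where "f x = of_bool (x = c) - pmf \<mu> c" for x
    have "(\<Sum>x\<in>UNIV. pmf \<mu> x * f x) = (\<Sum>x\<in>UNIV. if x = c then pmf \<mu> x else 0) - (\<Sum>x\<in>UNIV. pmf \<mu> x) * pmf \<mu> c"
      unfolding sum_distrib_right sum_subtractf[symmetric] by (intro sum.cong refl) (simp add: f_def algebra_simps)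
    also have "\<dots> = 0" by (simp add: sum_pmf_UNIV)
    finally obtain g where g: "\<And>x. g x - (\<Sum>y\<in>UNIV. pmf (K x) y * g y) = f x"
      using poisson_equation[OF invariant irreducible] by metis
    define G where "G = (\<Sum>x\<in>UNIV. \<bar>g x\<bar>)"
    have G: "\<bar>g x\<bar> \<le> G" for x
      unfolding G_def by (rule member_le_sum) auto
    define Z where "Z r s = (\<Sum>n=1..r. g (s (Suc n)) - (\<Sum>y\<in>UNIV. pmf (K (s n)) y * g y))" for r s
    \<comment> \<open>Summing \<open>f = g - K g\<close> along the path and shifting the index of
      \<open>g\<close> by one telescopes, leaving only the two end values.\<close>
    have vis: "visits s r c - r * pmf \<mu> c = Z r s + (g (s 1) - g (s (Suc r)))" for r s
    proof (induction r)
      case 0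
      then show ?case by (simp add: visits_def Z_def)
    next
      case (Suc r)
      have "visits s (Suc r) c = visits s r c + of_bool (s (Suc r) = c)"
        by (simp add: visits_def)
      moreover have "Z (Suc r) s = Z r s + (g (s (Suc (Suc r))) - g (s (Suc r)) + f (s (Suc r)))"
        using g[of "s (Suc r)"] by (simp add: Z_def)
      ultimately show ?case
        using Suc.IH by (simp add: f_def algebra_simps)
    qed
    have Z_path: "Z r s = Z r t" if "\<forall>k\<in>{1..Suc r}. s k = t k" for r s t
      unfolding Z_def using that by (intro sum.cong refl) auto
    have "expectation (\<lambda>\<omega>. (visits (\<lambda>k. C k \<omega>) r c - r * pmf \<mu> c)\<^sup>2) \<le> 16 * G\<^sup>2 * r" if r: "r \<ge> 1" for r
    proof -
      have int: "integrable M (\<lambda>\<omega>. (Z r (\<lambda>k. C k \<omega>))\<^sup>2)"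
        by (rule path_integrable[of "Suc r" "\<lambda>s. (Z r s)\<^sup>2"]) (metis Z_path)
      have int': "integrable M (\<lambda>\<omega>. (visits (\<lambda>k. C k \<omega>) r c - r * pmf \<mu> c)\<^sup>2)"
        by (rule path_integrable[of r "\<lambda>s. (visits s r c - r * pmf \<mu> c)\<^sup>2"])
           (auto simp: visits_def intro!: sum.cong arg_cong[where f = "\<lambda>x. (x - r * pmf \<mu> c)\<^sup>2"])
      have "(visits s r c - r * pmf \<mu> c)\<^sup>2 \<le> 2 * (Z r s)\<^sup>2 + 8 * G\<^sup>2" for s
      proof -
        have sq: "(x + y)\<^sup>2 \<le> 2 * x\<^sup>2 + 2 * y\<^sup>2" for x y :: real
          using sum_squares_bound[of x y] by (simp add: power2_sum)
        have "\<bar>g (s 1) - g (s (Suc r))\<bar> \<le> 2 * G"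
          using G[of "s 1"] G[of "s (Suc r)"] by linarith
        hence "(g (s 1) - g (s (Suc r)))\<^sup>2 \<le> (2 * G)\<^sup>2"
          using abs_le_square_iff by fastforce
        thus ?thesis unfolding vis using sq[of "Z r s" "g (s 1) - g (s (Suc r))"]
          by (simp add: power_mult_distrib)
      qed
      hence "expectation (\<lambda>\<omega>. (visits (\<lambda>k. C k \<omega>) r c - r * pmf \<mu> c)\<^sup>2)
          \<le> expectation (\<lambda>\<omega>. 2 * (Z r (\<lambda>k. C k \<omega>))\<^sup>2 + 8 * G\<^sup>2)"
        using int int' by (intro integral_mono) auto
      also have "\<dots> = 2 * expectation (\<lambda>\<omega>. (Z r (\<lambda>k. C k \<omega>))\<^sup>2) + 8 * G\<^sup>2"
        using int by (simp add: prob_space)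
      \<comment> \<open>The constant boundary term is absorbed into the linear one since
        \<open>r \<ge> 1\<close>.\<close>
      also have "\<dots> \<le> 2 * (r * (2 * G)\<^sup>2) + 8 * G\<^sup>2 * r"
        using martingale_second_moment[of g G r] G r
        by (intro add_mono mult_left_mono) (auto simp: Z_def mult_le_cancel_left1)
      also have "\<dots> = 16 * G\<^sup>2 * r"
        by (simp add: power_mult_distrib)
      finally show ?thesis .
    qed
    thus ?thesis by blast
  qed
  then obtain A where A: "\<And>c r. r \<ge> 1 \<Longrightarrow> expectation (\<lambda>\<omega>. (visits (\<lambda>k. C k \<omega>) r c - r * pmf \<mu> c)\<^sup>2) \<le> A c * r"
    by metis
  show thesis
  proof (rule that)
    show "(\<Sum>c\<in>UNIV. \<bar>A c\<bar>) + 1 > 0" by (simp add: add_nonneg_pos sum_nonneg)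
    fix r :: nat and c assume "r \<ge> 1"
    note A[OF this]
    also have "A c \<le> (\<Sum>c\<in>UNIV. \<bar>A c\<bar>) + 1"
      using member_le_sum[of c UNIV "\<lambda>c. \<bar>A c\<bar>"] by simp
    finally show "expectation (\<lambda>\<omega>. (visits (\<lambda>k. C k \<omega>) r c - r * pmf \<mu> c)\<^sup>2) \<le> ((\<Sum>c\<in>UNIV. \<bar>A c\<bar>) + 1) * r"
      by (simp add: mult_right_mono)
  qed
qed

section \<open>Concentration of the visit counts\<close>

definition deviation :: "real \<Rightarrow> nat \<Rightarrow> 'w set" where
  "deviation \<eta> r = {\<omega>\<in>space M. \<exists>c. \<bar>visits (\<lambda>k. C k \<omega>) r c - r * pmf \<mu> c\<bar> \<ge> \<eta> * r}"

lemma deviation_sets: "deviation \<eta> r \<in> sets M"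
  unfolding deviation_def
  by (rule path_measurable[of r "\<lambda>s. \<exists>c. \<bar>visits s r c - r * pmf \<mu> c\<bar> \<ge> \<eta> * r"])
     (metis visits_cong)

text \<open>Chebyshev's inequality for each state, then a union bound over the states.\<close>

lemma deviation_prob:
  obtains A where "A > 0" "\<And>\<eta> r. \<eta> > 0 \<Longrightarrow> r \<ge> 1 \<Longrightarrow> prob (deviation \<eta> r) \<le> A / (\<eta>\<^sup>2 * r)"
proof -
  obtain A where A: "A > 0"
    "\<And>r c. r \<ge> 1 \<Longrightarrow> expectation (\<lambda>\<omega>. (visits (\<lambda>k. C k \<omega>) r c - r * pmf \<mu> c)\<^sup>2) \<le> A * r"
    by (rule visits_second_moment) blast
  show thesis
  proof (rule that)
    show "A * CARD('c) > 0" using A by simp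
    fix \<eta> :: real and r :: nat assume \<eta>: "\<eta> > 0" and r: "r \<ge> 1"
    define D where "D c = {\<omega>\<in>space M. \<bar>visits (\<lambda>k. C k \<omega>) r c - r * pmf \<mu> c\<bar> \<ge> \<eta> * r}" for c
    have D_sets: "D c \<in> sets M" for c
      unfolding D_def by (rule path_measurable[of r "\<lambda>s. \<bar>visits s r c - r * pmf \<mu> c\<bar> \<ge> \<eta> * r"])
        (metis visits_cong)
    have D_prob: "prob (D c) \<le> A / (\<eta>\<^sup>2 * r)" for c
    proof -
      have "integrable M (\<lambda>\<omega>. visits (\<lambda>k. C k \<omega>) r c - r * pmf \<mu> c)"
        by (rule path_integrable[of r "\<lambda>s. visits s r c - r * pmf \<mu> c"]) (metis visits_cong)
      moreover have "integrable M (\<lambda>\<omega>. (visits (\<lambda>k. C k \<omega>) r c - r * pmf \<mu> c)\<^sup>2)"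
        by (rule path_integrable[of r "\<lambda>s. (visits s r c - r * pmf \<mu> c)\<^sup>2"]) (metis visits_cong)
      ultimately have "prob (D c) \<le> expectation (\<lambda>\<omega>. (visits (\<lambda>k. C k \<omega>) r c - r * pmf \<mu> c)\<^sup>2) / (\<eta> * r)\<^sup>2"
        unfolding D_def using \<eta> r by (intro second_moment_method) auto
      also have "\<dots> \<le> (A * r) / (\<eta> * r)\<^sup>2"
        using A(2) r by (intro divide_right_mono) auto
      also have "\<dots> = A / (\<eta>\<^sup>2 * r)"
        using \<eta> r by (simp add: power2_eq_square field_simps)
      finally show ?thesis .
    qed
    have "deviation \<eta> r = (\<Union>c. D c)"
      by (auto simp: deviation_def D_def)
    hence "prob (deviation \<eta> r) \<le> (\<Sum>c\<in>UNIV. prob (D c))"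
      using D_sets by (auto intro!: finite_measure_subadditive_finite)
    also have "\<dots> \<le> (\<Sum>c\<in>(UNIV :: 'c set). A / (\<eta>\<^sup>2 * r))"
      by (intro sum_mono D_prob)
    finally show "prob (deviation \<eta> r) \<le> A * CARD('c) / (\<eta>\<^sup>2 * r)"
      by (simp add: mult.commute)
  qed
qed

definition \<mu>_min :: real where
  "\<mu>_min = Min (range (pmf \<mu>))"

lemma \<mu>_pos: "pmf \<mu> c > 0"
  using irreducible_invariant_pos[OF invariant irreducible] .

lemma \<mu>_min_pos: "\<mu>_min > 0"
  unfolding \<mu>_min_def by (subst Min_gr_iff) (auto simp: \<mu>_pos)

lemma \<mu>_min_le: "\<mu>_min \<le> pmf \<mu> c"
  unfolding \<mu>_min_def by (rule Min_le) auto

text \<open>The upper bound on a policy inspects one deterministic round only, so a single deviation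
  event suffices. Taking \<open>\<eta> = \<delta> * \<mu>_min\<close> turns the absolute error
  \<open>\<eta> * r\<close> into a relative error \<open>\<delta>\<close> for every state.\<close>

lemma visits_upper:
  fixes \<delta> :: real
  assumes \<delta>: "\<delta> > 0"
  obtains n0 where "\<And>r. r \<ge> n0 \<Longrightarrow> \<exists>G\<in>sets M. prob G \<ge> 1 - \<delta> \<and>
     (\<forall>\<omega>\<in>G. \<forall>c. visits (\<lambda>k. C k \<omega>) r c \<le> (1 + \<delta>) * r * pmf \<mu> c)"
proof -
  obtain A where A: "A > 0"
    "\<And>\<eta> r. \<eta> > 0 \<Longrightarrow> r \<ge> 1 \<Longrightarrow> prob (deviation \<eta> r) \<le> A / (\<eta>\<^sup>2 * r)"
    by (rule deviation_prob) blast
  define \<eta> where "\<eta> = \<delta> * \<mu>_min"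
  have \<eta>: "\<eta> > 0" using \<delta> \<mu>_min_pos by (simp add: \<eta>_def)
  show thesis
  proof (rule that)
    fix r assume r: "r \<ge> max 1 (nat \<lceil>A / (\<eta>\<^sup>2 * \<delta>)\<rceil>)"
    show "\<exists>G\<in>sets M. prob G \<ge> 1 - \<delta> \<and>
      (\<forall>\<omega>\<in>G. \<forall>c. visits (\<lambda>k. C k \<omega>) r c \<le> (1 + \<delta>) * r * pmf \<mu> c)"
    proof (intro bexI conjI ballI allI)
      have "A / (\<eta>\<^sup>2 * \<delta>) \<le> r" using r by linarith
      hence "A / (\<eta>\<^sup>2 * r) \<le> \<delta>" using \<eta> \<delta> r by (simp add: field_simps)
      hence "prob (deviation \<eta> r) \<le> \<delta>" using A(2)[OF \<eta>, of r] r by simp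
      thus "1 - \<delta> \<le> prob (space M - deviation \<eta> r)"
        by (simp add: prob_compl deviation_sets)
      show "space M - deviation \<eta> r \<in> sets M"
        using deviation_sets by auto
      fix \<omega> c assume "\<omega> \<in> space M - deviation \<eta> r"
      hence "visits (\<lambda>k. C k \<omega>) r c - r * pmf \<mu> c \<le> \<eta> * r"
        by (auto simp: deviation_def not_le dest!: spec[of _ c])
      also have "\<eta> * r \<le> \<delta> * pmf \<mu> c * r"
        unfolding \<eta>_def using \<delta> \<mu>_min_le by (intro mult_right_mono mult_left_mono) auto
      finally show "visits (\<lambda>k. C k \<omega>) r c \<le> (1 + \<delta>) * r * pmf \<mu> c"
        by (simp add: algebra_simps)
    qed
  qed
qed

text \<open>The visit counts are monotone in time, so it suffices to control them on an arithmetic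
  grid of boundedly many times with mesh proportional to \<open>n\<close>.\<close>

lemma visits_lower:
  fixes \<delta> \<kappa> :: real
  assumes \<delta>: "0 < \<delta>" "\<delta> < 1"
  obtains n0 where "\<And>n::real. n \<ge> n0 \<Longrightarrow> \<exists>G\<in>sets M. prob G \<ge> 1 - \<delta> \<and>
     (\<forall>\<omega>\<in>G. \<forall>r::nat. n < r \<longrightarrow> r < \<kappa> * n \<longrightarrow>
        (\<forall>c. visits (\<lambda>k. C k \<omega>) r c \<ge> (1 - \<delta>) * r * pmf \<mu> c))"
proof -
  obtain A where A: "A > 0"
    "\<And>\<eta> r. \<eta> > 0 \<Longrightarrow> r \<ge> 1 \<Longrightarrow> prob (deviation \<eta> r) \<le> A / (\<eta>\<^sup>2 * r)"
    by (rule deviation_prob) blast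
  \<comment> \<open>Two relative errors \<open>\<theta>\<close> are spent: one for the deviation at
    a grid time, one for rounding \<open>r\<close> down to the grid.\<close>
  define \<theta> where "\<theta> = \<delta> / 2"
  have \<theta>: "0 < \<theta>" "\<theta> < 1" "1 - \<delta> \<le> (1 - \<theta>) * (1 - \<theta>)"
    using \<delta> by (auto simp: \<theta>_def algebra_simps)
  define \<eta> where "\<eta> = \<theta> * \<mu>_min"
  have \<eta>: "\<eta> > 0" using \<theta> \<mu>_min_pos by (simp add: \<eta>_def)
  \<comment> \<open>The mesh \<open>w\<close> will be at least \<open>\<theta> * n / 2\<close>, so
    \<open>J\<close> grid points reach beyond \<open>\<kappa> * n\<close>, however large
    \<open>n\<close> is.\<close>
  define J where "J = nat \<lceil>2 * \<kappa> / \<theta>\<rceil>"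
  \<comment> \<open>Chosen so that the rounded mesh \<open>w \<ge> \<theta> * n - 1\<close> is at
    least 1 and large enough for the \<open>J\<close> deviation probabilities to sum to at most
    \<open>\<delta>\<close>.\<close>
  define n0 where "n0 = (max 1 (J * A / (\<eta>\<^sup>2 * \<delta>)) + 1) / \<theta>"
  show thesis
  proof (rule that)
    fix n :: real assume n: "n \<ge> n0"
    define w where "w = nat \<lfloor>\<theta> * n\<rfloor>"
    define G where "G = space M - (\<Union>j\<in>{1..J}. deviation \<eta> (j * w))"
    have big: "\<theta> * n \<ge> max 1 (J * A / (\<eta>\<^sup>2 * \<delta>)) + 1"
      using n \<theta> by (simp add: n0_def field_simps)
    have w_ge: "w \<ge> \<theta> * n - 1" and w_le: "w \<le> \<theta> * n" unfolding w_def using big by linarith+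
    have w1: "w \<ge> 1" using w_ge big by linarith
    have n_pos: "n > 0" using big \<theta> by (smt (verit) mult_nonneg_nonpos)
    show "\<exists>G\<in>sets M. prob G \<ge> 1 - \<delta> \<and>
     (\<forall>\<omega>\<in>G. \<forall>r::nat. n < r \<longrightarrow> r < \<kappa> * n \<longrightarrow>
        (\<forall>c. visits (\<lambda>k. C k \<omega>) r c \<ge> (1 - \<delta>) * r * pmf \<mu> c))"
    proof (intro bexI conjI ballI allI impI)
      have "prob (\<Union>j\<in>{1..J}. deviation \<eta> (j * w)) \<le> (\<Sum>j\<in>{1..J}. prob (deviation \<eta> (j * w)))"
        using deviation_sets by (intro finite_measure_subadditive_finite) auto
      also have "\<dots> \<le> (\<Sum>j\<in>{1..J}. A / (\<eta>\<^sup>2 * w))"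
      proof (rule sum_mono)
        fix j assume j: "j \<in> {1..J}"
        have "prob (deviation \<eta> (j * w)) \<le> A / (\<eta>\<^sup>2 * (j * w))"
          using A(2)[OF \<eta>, of "j * w"] j w1 by simp
        also have "\<dots> \<le> A / (\<eta>\<^sup>2 * w)"
          using A j w1 \<eta> by (intro divide_left_mono mult_left_mono) auto
        finally show "prob (deviation \<eta> (j * w)) \<le> A / (\<eta>\<^sup>2 * w)" .
      qed
      also have "\<dots> = J * A / (\<eta>\<^sup>2 * w)" by simp
      also have "\<dots> \<le> \<delta>"
      proof -
        have "J * A / (\<eta>\<^sup>2 * \<delta>) \<le> w" using big w_ge by linarith
        thus ?thesis using \<eta> \<delta> w1 by (simp add: field_simps)
      qed
      finally show "1 - \<delta> \<le> prob G"
        unfolding G_def using deviation_sets by (subst prob_compl) auto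
      show "G \<in> sets M"
        unfolding G_def using deviation_sets by auto
      fix \<omega> c and r :: nat assume \<omega>: "\<omega> \<in> G" and r: "n < r" "r < \<kappa> * n"
      \<comment> \<open>\<open>j * w\<close> is the last grid time up to \<open>r\<close>. It misses
        \<open>r\<close> by less than \<open>w\<close>, and
        \<open>w \<le> \<theta> * n \<le> \<theta> * r\<close>.\<close>
      define j where "j = r div w"
      have jw: "j * w \<le> r" "r < j * w + w"
        using w1 dividend_less_div_times[of w r] by (simp_all add: j_def div_times_less_eq_dividend add.commute)
      have "real w < r" using w_le r n_pos \<theta> by (smt (verit) mult_le_cancel_right1)
      hence "j \<ge> 1" using w1 by (simp add: j_def div_greater_zero_iff Suc_le_eq)
      moreover have "j \<le> J"
      proof -
        have "\<theta> * n / 2 \<le> w" using w_ge big by linarith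
        hence "j * (\<theta> * n / 2) \<le> j * real w" by (intro mult_left_mono) auto
        also have "\<dots> \<le> r" using jw(1) by (metis of_nat_le_iff of_nat_mult)
        also have "\<dots> \<le> \<kappa> * n" using r by simp
        finally have "j \<le> 2 * \<kappa> / \<theta>" using \<theta> n_pos by (simp add: field_simps)
        thus ?thesis unfolding J_def by linarith
      qed
      ultimately have "\<omega> \<in> space M - deviation \<eta> (j * w)"
        using \<omega> by (auto simp: G_def)
      hence dev: "visits (\<lambda>k. C k \<omega>) (j * w) c - (j * w) * pmf \<mu> c \<ge> - (\<eta> * (j * w))"
        by (auto simp: deviation_def not_le dest!: spec[of _ c])
      have "(1 - \<delta>) * r * pmf \<mu> c \<le> ((1 - \<theta>) * (1 - \<theta>)) * r * pmf \<mu> c"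
        using \<theta> by (intro mult_right_mono) auto
      also have "\<dots> = (1 - \<theta>) * pmf \<mu> c * (r - \<theta> * r)"
        by (simp add: algebra_simps)
      also have "\<dots> \<le> (1 - \<theta>) * pmf \<mu> c * (j * w)"
      proof (intro mult_left_mono)
        have "r \<le> real (j * w + w)" using jw by linarith
        moreover have "w \<le> \<theta> * r" using w_le r \<theta> by (smt (verit) mult_left_mono)
        ultimately show "r - \<theta> * r \<le> real (j * w)" by simp
      qed (use \<theta> in auto)
      also have "\<dots> = (j * w) * pmf \<mu> c - \<theta> * pmf \<mu> c * (j * w)"
        by (simp add: algebra_simps)
      also have "\<dots> \<le> (j * w) * pmf \<mu> c - \<eta> * (j * w)"
        unfolding \<eta>_def using \<theta> \<mu>_min_le by (intro diff_left_mono mult_right_mono mult_left_mono) auto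
      also have "\<dots> \<le> visits (\<lambda>k. C k \<omega>) (j * w) c" using dev by simp
      also have "\<dots> \<le> visits (\<lambda>k. C k \<omega>) r c" by (rule visits_mono) (rule jw)
      finally show "(1 - \<delta>) * r * pmf \<mu> c \<le> visits (\<lambda>k. C k \<omega>) r c" .
    qed
  qed
qed

end

subsection \<open>Stopping rounds and stationary allocations\<close>

text \<open>The criterion of Assumption 1 for the sequence \<open>a n = N (h(q n))\<close>. The
  least element is meaningful once some round qualifies, which holds for every sequence bounded
  above (\<open>stop_round_props\<close>).\<close>

definition stop_round :: "(nat \<Rightarrow> real) \<Rightarrow> nat" where
  "stop_round a = (LEAST r. 1 \<le> r \<and> real r > (1 / real r) * (\<Sum>n=1..r. a n))"

lemma stop_round_le:
  assumes "r \<ge> 1" "(\<Sum>n=1..r. a n) < real r * real r"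
  shows "stop_round a \<le> r"
  unfolding stop_round_def using assms by (intro Least_le) (auto simp: field_simps)

lemma sum_less_square:
  assumes "\<And>n. n \<ge> 1 \<Longrightarrow> a n \<le> b" "b < real r" "r \<ge> 1"
  shows "(\<Sum>n=1..r. a n) < real r * real r"
proof -
  have "(\<Sum>n=1..r. a n) \<le> (\<Sum>n=1..r. b)"
    by (intro sum_mono assms) auto
  also have "\<dots> = real r * b" by simp
  also have "\<dots> < real r * real r" using assms by simp
  finally show ?thesis .
qed

lemma stop_round_le_bound:
  assumes "\<And>n. n \<ge> 1 \<Longrightarrow> a n \<le> b"
  shows "stop_round a \<le> nat \<lfloor>b\<rfloor> + 1"
proof (rule stop_round_le[OF _ sum_less_square])
  show "b < real (nat \<lfloor>b\<rfloor> + 1)" by linarith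
qed (use assms in auto)

lemma stop_round_props:
  assumes "\<And>n. n \<ge> 1 \<Longrightarrow> a n \<le> b"
  shows "stop_round a \<ge> 1" "(\<Sum>n=1..stop_round a. a n) < real (stop_round a) * real (stop_round a)"
proof -
  define r where "r = nat \<lfloor>b\<rfloor> + 1"
  have "b < real r" unfolding r_def by linarith
  hence "(\<Sum>n=1..r. a n) < real r * real r"
    using assms by (intro sum_less_square) (auto simp: r_def)
  hence "1 \<le> r \<and> real r > (1 / real r) * (\<Sum>n=1..r. a n)"
    by (auto simp: r_def field_simps)
  hence *: "1 \<le> stop_round a \<and> real (stop_round a) > (1 / real (stop_round a)) * (\<Sum>n=1..stop_round a. a n)"
    unfolding stop_round_def by (rule LeastI)
  thus "stop_round a \<ge> 1" by simp
  with * show "(\<Sum>n=1..stop_round a. a n) < real (stop_round a) * real (stop_round a)"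
    by (simp add: field_simps)
qed

text \<open>For sequences bounded by \<open>b\<close> the stopping decision has been made by round
  \<open>nat \<lfloor>b\<rfloor> + 1\<close>. This makes stopped sums functions of a finite prefix,
  hence integrable.\<close>

lemma stop_round_cong:
  assumes a: "\<And>n. n \<ge> 1 \<Longrightarrow> a n \<le> b" and a': "\<And>n. n \<ge> 1 \<Longrightarrow> a' n \<le> b"
    and eq: "\<And>n. n \<in> {1..nat \<lfloor>b\<rfloor> + 1} \<Longrightarrow> a n = a' n"
  shows "stop_round a = stop_round a'"
proof (rule antisym)
  have sums: "(\<Sum>n=1..r. a n) = (\<Sum>n=1..r. a' n)" if "r \<le> nat \<lfloor>b\<rfloor> + 1" for r
    using that by (intro sum.cong refl eq) auto
  note props = stop_round_props[of a b, OF a] stop_round_props[of a' b, OF a']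
  note le = stop_round_le_bound[of a b, OF a] stop_round_le_bound[of a' b, OF a']
  show "stop_round a \<le> stop_round a'"
    using props le(2) sums[OF le(2)] by (intro stop_round_le) auto
  show "stop_round a' \<le> stop_round a"
    using props le(1) sums[OF le(1)] by (intro stop_round_le) auto
qed

lemma visits_card: "visits s r c = real (card {n\<in>{1..r}. s n = c})"
proof -
  have "visits s r c = (\<Sum>n\<in>{1..r}. if s n = c then 1 else 0)"
    unfolding visits_def by (intro sum.cong refl) auto
  also have "\<dots> = (\<Sum>n\<in>{n\<in>{1..r}. s n = c}. 1)"
    by (rule sum.inter_filter[symmetric]) simp
  finally show ?thesis by simp
qed

lemma convex_on_average:
  assumes f: "convex_on B f" and "finite I" "I \<noteq> {}" "\<And>i. i \<in> I \<Longrightarrow> x i \<in> B"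
  shows "real (card I) * f (\<Sum>i\<in>I. (1 / card I) *\<^sub>R x i) \<le> (\<Sum>i\<in>I. f (x i))"
proof -
  have "f (\<Sum>i\<in>I. (1 / card I) *\<^sub>R x i) \<le> (\<Sum>i\<in>I. (1 / card I) * f (x i))"
    by (rule convex_on_sum[OF assms(2,3) f]) (use assms in auto)
  also have "\<dots> = (1 / card I) * (\<Sum>i\<in>I. f (x i))"
    by (simp add: sum_distrib_left)
  finally show ?thesis
    using assms by (simp add: field_simps card_gt_0_iff)
qed

text \<open>The deterministic problem at a fixed tolerance: \<open>B\<close> will be the image of
  the parameter cube under \<open>h\<close>, \<open>f\<close> the duration in the new variables and
  \<open>p\<close> the invariant distribution. Of the norm only convexity and boundedness on
  \<open>B\<close> enter.\<close>

locale allocation =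
  fixes B :: "'v::real_vector set" and N :: "'v \<Rightarrow> real" and f :: "'v \<Rightarrow> 'c::finite \<Rightarrow> real"
    and p :: "'c \<Rightarrow> real" and f_min f_max N_max :: real
  assumes B_nonempty: "B \<noteq> {}"
    and N_convex: "convex_on B N" and f_convex: "\<And>c. convex_on B (\<lambda>x. f x c)"
    and f_min_pos: "f_min > 0"
    and f_bounds: "\<And>x c. x \<in> B \<Longrightarrow> f_min \<le> f x c" "\<And>x c. x \<in> B \<Longrightarrow> f x c \<le> f_max"
    and N_bounds: "\<And>x. x \<in> B \<Longrightarrow> 0 \<le> N x" "\<And>x. x \<in> B \<Longrightarrow> N x \<le> N_max"
    and p_pos: "\<And>c. p c > 0" and p_sum: "(\<Sum>c\<in>UNIV. p c) = 1"
begin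

definition mean_N :: "('c \<Rightarrow> 'v) \<Rightarrow> real" where
  "mean_N y = (\<Sum>c\<in>UNIV. p c * N (y c))"

definition mean_f :: "('c \<Rightarrow> 'v) \<Rightarrow> real" where
  "mean_f y = (\<Sum>c\<in>UNIV. p c * f (y c) c)"

definition N_min :: real where
  "N_min = (INF x\<in>B. N x)"

definition policies :: "('c \<Rightarrow> 'v) set" where
  "policies = {y. \<forall>c. y c \<in> B}"

definition opt_value :: real where
  "opt_value = (INF y\<in>policies. mean_N y * mean_f y)"

lemma N_min_le: "x \<in> B \<Longrightarrow> N_min \<le> N x"
  unfolding N_min_def by (rule cINF_lower) (auto intro!: bdd_belowI[of _ 0] N_bounds)

lemma N_min_ge: "(\<And>x. x \<in> B \<Longrightarrow> k \<le> N x) \<Longrightarrow> k \<le> N_min"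
  unfolding N_min_def by (rule cINF_greatest) (use B_nonempty in auto)

lemma policies_nonempty: "policies \<noteq> {}"
proof -
  obtain x where "x \<in> B" using B_nonempty by auto
  hence "(\<lambda>c. x) \<in> policies" by (simp add: policies_def)
  thus ?thesis by auto
qed

lemma weighted_mean_ge: "(\<And>c. k \<le> g c) \<Longrightarrow> k \<le> (\<Sum>c\<in>UNIV. p c * g c)"
  using sum_mono[of UNIV "\<lambda>c. p c * k" "\<lambda>c. p c * g c"] p_pos p_sum
  by (simp add: less_imp_le mult_left_mono flip: sum_distrib_right)

lemma weighted_mean_le: "(\<And>c. g c \<le> k) \<Longrightarrow> (\<Sum>c\<in>UNIV. p c * g c) \<le> k"
  using sum_mono[of UNIV "\<lambda>c. p c * g c" "\<lambda>c. p c * k"] p_pos p_sum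
  by (simp add: less_imp_le mult_left_mono flip: sum_distrib_right)

lemma mean_N_ge: "(\<And>c. y c \<in> B) \<Longrightarrow> N_min \<le> mean_N y"
  unfolding mean_N_def by (rule weighted_mean_ge) (rule N_min_le)

lemma mean_f_ge: "(\<And>c. y c \<in> B) \<Longrightarrow> f_min \<le> mean_f y"
  unfolding mean_f_def by (rule weighted_mean_ge) (rule f_bounds)

lemma N_min_nonneg: "0 \<le> N_min"
  by (rule N_min_ge) (rule N_bounds)

lemma opt_value_le:
  assumes "\<And>c. y c \<in> B"
  shows "opt_value \<le> mean_N y * mean_f y"
  unfolding opt_value_def
proof (rule cINF_lower)
  show "bdd_below ((\<lambda>y. mean_N y * mean_f y) ` policies)"
  proof (rule bdd_belowI2[of _ 0])
    fix y assume "y \<in> policies"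
    thus "0 \<le> mean_N y * mean_f y"
      using mean_N_ge[of y] mean_f_ge[of y] N_min_nonneg f_min_pos
      by (intro mult_nonneg_nonneg) (auto simp: policies_def)
  qed
qed (use assms in \<open>auto simp: policies_def\<close>)

text \<open>Makes the value grow with \<open>N_min\<close>, so that an additive slack in the choice
  of the policy becomes negligible.\<close>

lemma opt_value_ge: "N_min * f_min \<le> opt_value"
  unfolding opt_value_def
proof (rule cINF_greatest[OF policies_nonempty])
  fix y assume "y \<in> policies"
  thus "N_min * f_min \<le> mean_N y * mean_f y"
    using mean_N_ge[of y] mean_f_ge[of y] N_min_nonneg f_min_pos
    by (intro mult_mono) (auto simp: policies_def)
qed

lemma near_optimal_policy:
  assumes "opt_value < k"
  obtains y where "\<And>c. y c \<in> B" "mean_N y * mean_f y < k"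
proof -
  have "\<exists>z\<in>(\<lambda>y. mean_N y * mean_f y) ` policies. z < k"
    using assms policies_nonempty unfolding opt_value_def by (intro cInf_lessD) auto
  thus thesis using that by (auto simp: policies_def)
qed

lemma f_max_pos: "f_max > 0"
  using B_nonempty f_bounds f_min_pos by (metis equals0I less_le_trans order.trans)

text \<open>Compare with policies using the same \<open>x\<close> in every state, whose value is at
  most \<open>N x * f_max\<close>. This confines the relevant stopping rounds to within a constant
  factor of \<open>N_min\<close>.\<close>

lemma opt_value_le_N_min: "opt_value \<le> f_max * N_min"
proof -
  have "opt_value / f_max \<le> N x" if x: "x \<in> B" for x
  proof -
    have "opt_value \<le> mean_N (\<lambda>_. x) * mean_f (\<lambda>_. x)"
      by (rule opt_value_le) (rule x)
    also have "mean_N (\<lambda>_. x) = N x"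
      unfolding mean_N_def by (simp add: p_sum flip: sum_distrib_right)
    also have "N x * mean_f (\<lambda>_. x) \<le> N x * f_max"
      unfolding mean_f_def using x
      by (intro mult_left_mono weighted_mean_le f_bounds N_bounds)
    finally show ?thesis using f_max_pos by (simp add: field_simps)
  qed
  hence "opt_value / f_max \<le> N_min" by (rule N_min_ge)
  thus ?thesis using f_max_pos by (simp add: field_simps)
qed

text \<open>By Jensen's inequality, replacing the parameters used in each state by their average
  only helps, so no schedule does better than a stationary policy for its own visit counts.\<close>

lemma schedule_lower_bound:
  fixes s :: "nat \<Rightarrow> 'c"
  assumes x: "\<And>n. n \<ge> 1 \<Longrightarrow> x n \<in> B" and r: "r \<ge> 1" and \<delta>: "0 \<le> \<delta>" "\<delta> < 1"
    and stop: "(\<Sum>n=1..r. N (x n)) < real r * real r"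
    and vis: "\<And>c. visits s r c \<ge> (1 - \<delta>) * r * p c"
  shows "(1 - \<delta>)\<^sup>2 * opt_value \<le> (\<Sum>n=1..r. f (x n) (s n))"
proof -
  define I where "I c = {n\<in>{1..r}. s n = c}" for c
  define y where "y c = (\<Sum>n\<in>I c. (1 / card (I c)) *\<^sub>R x n)" for c
  \<comment> \<open>Every state is visited, so each average \<open>y c\<close> is over a nonempty
    set of rounds and lies in \<open>B\<close>.\<close>
  have vis_pos: "visits s r c > 0" for c
  proof -
    have "0 < (1 - \<delta>) * r * p c"
      using p_pos \<delta> r by (intro mult_pos_pos) auto
    thus ?thesis using vis[of c] by linarith
  qed
  have card: "visits s r c = real (card (I c))" for c
    unfolding I_def by (rule visits_card)
  have fin: "finite (I c)" and ne: "I c \<noteq> {}" and xI: "n \<in> I c \<Longrightarrow> x n \<in> B" for c n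
    using vis_pos[of c] card[of c] x by (auto simp: card_gt_0_iff) (auto simp: I_def)
  have split: "(\<Sum>n=1..r. g n) = (\<Sum>c\<in>UNIV. \<Sum>n\<in>I c. g n)" for g :: "nat \<Rightarrow> real"
    unfolding I_def by (rule sum.group[symmetric]) auto
  have yB: "y c \<in> B" for c
    unfolding y_def using fin ne xI N_convex
    by (intro convex_sum) (auto simp: convex_on_def)
  have f_y: "(1 - \<delta>) * r * mean_f y \<le> (\<Sum>n=1..r. f (x n) (s n))"
  proof -
    have "(1 - \<delta>) * r * mean_f y = (\<Sum>c\<in>UNIV. ((1 - \<delta>) * r * p c) * f (y c) c)"
      by (simp add: mean_f_def sum_distrib_left mult.assoc)
    also have "\<dots> \<le> (\<Sum>c\<in>UNIV. visits s r c * f (y c) c)"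
      using f_bounds(1)[OF yB] f_min_pos by (intro sum_mono mult_right_mono vis) (meson less_imp_le order.trans)
    also have "\<dots> \<le> (\<Sum>c\<in>UNIV. \<Sum>n\<in>I c. f (x n) c)"
      unfolding card y_def by (intro sum_mono convex_on_average[where B = B] f_convex fin ne xI)
    also have "\<dots> = (\<Sum>c\<in>UNIV. \<Sum>n\<in>I c. f (x n) (s n))"
      by (intro sum.cong refl) (auto simp: I_def)
    finally show ?thesis unfolding split .
  qed
  \<comment> \<open>The stopping criterion caps the total of \<open>N\<close> by
    \<open>r * r\<close>; after Jensen one factor \<open>r\<close> cancels, and \<open>r\<close> is
    bounded below by \<open>(1 - \<delta>) * mean_N y\<close>.\<close>
  have "(1 - \<delta>) * r * mean_N y \<le> r * real r"
  proof -
    have "(1 - \<delta>) * r * mean_N y = (\<Sum>c\<in>UNIV. ((1 - \<delta>) * r * p c) * N (y c))"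
      by (simp add: mean_N_def sum_distrib_left mult.assoc)
    also have "\<dots> \<le> (\<Sum>c\<in>UNIV. visits s r c * N (y c))"
      using N_bounds(1)[OF yB] by (intro sum_mono mult_right_mono vis)
    also have "\<dots> \<le> (\<Sum>c\<in>UNIV. \<Sum>n\<in>I c. N (x n))"
      unfolding card y_def by (intro sum_mono convex_on_average[where B = B] N_convex fin ne xI)
    finally show ?thesis using stop unfolding split by simp
  qed
  hence N_y: "(1 - \<delta>) * mean_N y \<le> r"
    using r by (simp add: mult.assoc mult.left_commute[of "1 - \<delta>"])
  have "(1 - \<delta>)\<^sup>2 * opt_value \<le> (1 - \<delta>)\<^sup>2 * (mean_N y * mean_f y)"
    by (intro mult_left_mono opt_value_le yB) simp
  also have "\<dots> = ((1 - \<delta>) * mean_N y) * ((1 - \<delta>) * mean_f y)"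
    by (simp add: power2_eq_square)
  also have "\<dots> \<le> r * ((1 - \<delta>) * mean_f y)"
    using N_y mean_f_ge[of y, OF yB] f_min_pos \<delta> by (intro mult_right_mono mult_nonneg_nonneg) auto
  also have "\<dots> \<le> (\<Sum>n=1..r. f (x n) (s n))"
    using f_y by (simp add: mult.assoc mult.left_commute)
  finally show ?thesis .
qed

text \<open>A schedule whose number of rounds falls outside the range where the visit counts are
  controlled is too slow anyway: it needs more than \<open>N_min\<close> rounds, and at least
  \<open>opt_value / f_min\<close> rounds already take time \<open>opt_value\<close>.\<close>

lemma stopped_schedule_lower_bound:
  fixes s :: "nat \<Rightarrow> 'c"
  assumes x: "\<And>n. n \<ge> 1 \<Longrightarrow> x n \<in> B" and \<delta>: "0 \<le> \<delta>" "\<delta> < 1"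
    and vis: "\<And>r c. N_min < real r \<Longrightarrow> r < (f_max / f_min) * N_min \<Longrightarrow> visits s r c \<ge> (1 - \<delta>) * r * p c"
  shows "(1 - \<delta>)\<^sup>2 * opt_value \<le> (\<Sum>n=1..stop_round (\<lambda>n. N (x n)). f (x n) (s n))"
proof -
  define r where "r = stop_round (\<lambda>n. N (x n))"
  have r: "r \<ge> 1" "(\<Sum>n=1..r. N (x n)) < real r * real r"
    using stop_round_props[of "\<lambda>n. N (x n)" N_max] N_bounds x by (auto simp: r_def)
  have "(\<Sum>n=1..r. N_min) \<le> (\<Sum>n=1..r. N (x n))"
    using x N_min_le by (intro sum_mono) auto
  hence "real r * N_min \<le> (\<Sum>n=1..r. N (x n))" by simp
  hence "real r * N_min < real r * real r" using r(2) by linarith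
  hence N_min_less: "N_min < real r" using r by simp
  show ?thesis
  proof (cases "opt_value \<le> r * f_min")
    case True
    have "0 \<le> opt_value"
      using opt_value_ge N_min_nonneg f_min_pos by (meson less_imp_le mult_nonneg_nonneg order.trans)
    hence "(1 - \<delta>)\<^sup>2 * opt_value \<le> opt_value"
      using \<delta> by (simp add: mult_left_le_one_le power_le_one)
    also note True
    also have "r * f_min = (\<Sum>n=1..r. f_min)" by simp
    also have "\<dots> \<le> (\<Sum>n=1..r. f (x n) (s n))"
      using x f_bounds by (intro sum_mono) auto
    finally show ?thesis unfolding r_def .
  next
    case False
    hence "r < (f_max / f_min) * N_min"
      using opt_value_le_N_min f_min_pos by (simp add: field_simps)
    with N_min_less vis show ?thesis
      using schedule_lower_bound[of x r \<delta> s] x r \<delta> unfolding r_def by blast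
  qed
qed

end

subsection \<open>Expected time of a stationary policy\<close>

context irreducible_chain
begin

lemma policy_time_integrable:
  fixes a b :: "'c \<Rightarrow> real"
  shows "integrable M (\<lambda>\<omega>. \<Sum>n=1..stop_round (\<lambda>n. a (C n \<omega>)). b (C n \<omega>))"
proof -
  define A where "A = Max (range a)"
  have A: "a c \<le> A" for c unfolding A_def by (rule Max_ge) auto
  show ?thesis
  proof (rule path_integrable[of "nat \<lfloor>A\<rfloor> + 1" "\<lambda>s. \<Sum>n=1..stop_round (\<lambda>n. a (s n)). b (s n)"])
    fix s t :: "nat \<Rightarrow> 'c" assume st: "\<forall>k\<in>{1..nat \<lfloor>A\<rfloor> + 1}. s k = t k"
    have "stop_round (\<lambda>n. a (s n)) = stop_round (\<lambda>n. a (t n))"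
      by (rule stop_round_cong[where b = A]) (use A st in auto)
    moreover have "stop_round (\<lambda>n. a (t n)) \<le> nat \<lfloor>A\<rfloor> + 1"
      by (rule stop_round_le_bound) (rule A)
    ultimately show "(\<Sum>n=1..stop_round (\<lambda>n. a (s n)). b (s n)) = (\<Sum>n=1..stop_round (\<lambda>n. a (t n)). b (t n))"
      using st by (intro sum.cong) auto
  qed
qed

text \<open>The threshold must be uniform in \<open>a\<close> and \<open>b\<close>, because the
  policy varies with \<open>\<epsilon>\<close> while the duration bounds stay fixed. The exceptional
  event is harmless since even the worst stopping round is within a constant factor of the mean of
  \<open>a\<close>.\<close>

lemma policy_time_upper_bound:
  fixes b_min b_max \<delta> :: real
  assumes b_min: "b_min > 0" and \<delta>: "\<delta> > 0"
  obtains n0 :: real where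
    "\<And>a b. (\<And>c. 0 \<le> a c) \<Longrightarrow> (\<And>c. b_min \<le> b c) \<Longrightarrow> (\<And>c. b c \<le> b_max) \<Longrightarrow>
       n0 \<le> (\<Sum>c\<in>UNIV. pmf \<mu> c * a c) \<Longrightarrow>
       expectation (\<lambda>\<omega>. \<Sum>n=1..stop_round (\<lambda>n. a (C n \<omega>)). b (C n \<omega>))
         \<le> (1 + \<delta>) * ((\<Sum>c\<in>UNIV. pmf \<mu> c * a c) * (\<Sum>c\<in>UNIV. pmf \<mu> c * b c))"
proof -
  \<comment> \<open>The sign of \<open>b_max\<close> is known only once some \<open>b\<close> is
    given, hence the absolute value.\<close>
  define \<kappa> where "\<kappa> = \<bar>b_max\<bar> / b_min"
  \<comment> \<open>The sum of the relative errors in units of \<open>e\<close>: 5 from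
    \<open>(1 + e) * ((1 + e) + e) \<le> 1 + 5 * e\<close>, the rest from the exceptional
    event.\<close>
  define L where "L = 5 + \<kappa> * (1 / \<mu>_min + 1)"
  have \<kappa>: "\<kappa> \<ge> 0" using b_min by (simp add: \<kappa>_def)
  have L: "L \<ge> 5" using \<kappa> \<mu>_min_pos by (simp add: L_def)
  define e where "e = min 1 (\<delta> / L)"
  have e: "0 < e" "e \<le> 1" "e * L \<le> \<delta>"
    using \<delta> L by (auto simp: e_def min_def field_simps)
  obtain n1 where n1: "\<And>r. r \<ge> n1 \<Longrightarrow> \<exists>G\<in>sets M. prob G \<ge> 1 - e \<and>
     (\<forall>\<omega>\<in>G. \<forall>c. visits (\<lambda>k. C k \<omega>) r c \<le> (1 + e) * r * pmf \<mu> c)"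
    by (rule visits_upper[OF e(1)]) blast
  show thesis
  proof (rule that)
    fix a b :: "'c \<Rightarrow> real"
    assume a: "\<And>c. 0 \<le> a c" and b: "\<And>c. b_min \<le> b c" "\<And>c. b c \<le> b_max"
      and n0: "max (1 / e) n1 \<le> (\<Sum>c\<in>UNIV. pmf \<mu> c * a c)"
    define \<nu> where "\<nu> = (\<Sum>c\<in>UNIV. pmf \<mu> c * a c)"
    define F where "F = (\<Sum>c\<in>UNIV. pmf \<mu> c * b c)"
    define T where "T s = (\<Sum>n=1..stop_round (\<lambda>n. a (s n)). b (s n))" for s :: "nat \<Rightarrow> 'c"
    \<comment> \<open>This absorbs additive constants, such as the rounding in \<open>R\<close>,
      into relative errors.\<close>
    have e\<nu>: "1 \<le> e * \<nu>" using n0 e by (simp add: \<nu>_def field_simps)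
    have "0 \<le> \<nu>" unfolding \<nu>_def by (intro sum_nonneg mult_nonneg_nonneg a) auto
    hence \<nu>: "1 \<le> \<nu>" using e\<nu> e mult_right_mono[of e 1 \<nu>] by linarith
    have "(\<Sum>c\<in>UNIV. pmf \<mu> c * b_min) \<le> F"
      unfolding F_def by (intro sum_mono mult_left_mono b) auto
    hence F: "b_min \<le> F" by (simp add: sum_pmf_UNIV flip: sum_distrib_right)
    have b_pos: "0 \<le> b c" for c using b(1)[of c] b_min by linarith
    \<comment> \<open>The first integer above \<open>(1 + e) * \<nu>\<close>. On the good event the
      total of \<open>a\<close> up to \<open>R\<close> is at most
      \<open>(1 + e) * R * \<nu>\<close>, hence below \<open>R * R\<close>, so the policy has
      stopped by round \<open>R\<close>.\<close>
    define R where "R = nat \<lfloor>(1 + e) * \<nu>\<rfloor> + 1"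
    have R: "(1 + e) * \<nu> < R" "R \<le> (1 + e) * \<nu> + 1" "R \<ge> 1"
      using e \<nu> unfolding R_def by (simp_all add: add_nonneg_nonneg) linarith+
    have "n1 \<le> \<nu>" using n0 by (simp add: \<nu>_def)
    also have "\<nu> \<le> (1 + e) * \<nu>" using e \<nu> by simp
    finally have "n1 \<le> R" using R by linarith
    then obtain G where G: "G \<in> sets M" "prob G \<ge> 1 - e"
      "\<And>\<omega> c. \<omega> \<in> G \<Longrightarrow> visits (\<lambda>k. C k \<omega>) R c \<le> (1 + e) * R * pmf \<mu> c"
      using n1[of R] by blast
    have visits_sum: "(\<Sum>n=1..R. g (s n)) \<le> (1 + e) * R * (\<Sum>c\<in>UNIV. pmf \<mu> c * g c)"
      if "\<And>c. visits s R c \<le> (1 + e) * R * pmf \<mu> c" "\<And>c. 0 \<le> g c" for s :: "nat \<Rightarrow> 'c" and g :: "'c \<Rightarrow> real"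
    proof -
      have "(\<Sum>n=1..R. g (s n)) \<le> (\<Sum>c\<in>UNIV. ((1 + e) * R * pmf \<mu> c) * g c)"
        unfolding sum_visits by (intro sum_mono mult_right_mono that)
      thus ?thesis by (simp add: sum_distrib_left mult.assoc)
    qed
    have T_good: "T s \<le> (1 + e) * R * F" if s: "\<And>c. visits s R c \<le> (1 + e) * R * pmf \<mu> c" for s
    proof -
      have "(\<Sum>n=1..R. a (s n)) \<le> (1 + e) * R * \<nu>"
        unfolding \<nu>_def by (rule visits_sum[OF s a])
      also have "\<dots> = R * ((1 + e) * \<nu>)" by simp
      also have "\<dots> < real R * real R" using R by (intro mult_strict_left_mono) auto
      finally have "stop_round (\<lambda>n. a (s n)) \<le> R"
        using R by (intro stop_round_le) auto
      hence "T s \<le> (\<Sum>n=1..R. b (s n))"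
        unfolding T_def using b_pos by (intro sum_mono2) auto
      also have "\<dots> \<le> (1 + e) * R * F"
        unfolding F_def by (rule visits_sum[OF s b_pos])
      finally show ?thesis .
    qed
    \<comment> \<open>Crude bound for the exceptional event: \<open>\<nu>\<close> dominates each of
      its own terms, so \<open>a c \<le> \<nu> / \<mu>_min\<close>.\<close>
    have T_all: "T s \<le> b_max * (\<nu> / \<mu>_min + 1)" for s
    proof -
      have "a c \<le> \<nu> / \<mu>_min" for c
      proof -
        have "\<mu>_min * a c \<le> pmf \<mu> c * a c"
          by (intro mult_right_mono a \<mu>_min_le)
        also have "\<dots> \<le> \<nu>"
          unfolding \<nu>_def by (rule member_le_sum) (auto simp: a)
        finally show ?thesis using \<mu>_min_pos by (simp add: field_simps)
      qed
      hence "stop_round (\<lambda>n. a (s n)) \<le> nat \<lfloor>\<nu> / \<mu>_min\<rfloor> + 1"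
        by (intro stop_round_le_bound)
      moreover have "\<nu> / \<mu>_min \<ge> 0" using \<nu> \<mu>_min_pos by simp
      ultimately have stop: "stop_round (\<lambda>n. a (s n)) \<le> \<nu> / \<mu>_min + 1" by linarith
      have "T s \<le> stop_round (\<lambda>n. a (s n)) * b_max"
        unfolding T_def using sum_mono[of "{1..stop_round (\<lambda>n. a (s n))}" "\<lambda>n. b (s n)" "\<lambda>_. b_max"] b by simp
      also have "\<dots> \<le> (\<nu> / \<mu>_min + 1) * b_max"
        using stop b_pos[of undefined] b(2)[of undefined] by (intro mult_right_mono) auto
      finally show ?thesis by (simp add: mult.commute)
    qed
    have b_max: "0 \<le> b_max" "b_max = \<kappa> * b_min"
      using b_pos[of undefined] b(2)[of undefined] b_min by (auto simp: \<kappa>_def)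
    have "expectation (\<lambda>\<omega>. T (\<lambda>k. C k \<omega>))
        \<le> expectation (\<lambda>\<omega>. (1 + e) * R * F + b_max * (\<nu> / \<mu>_min + 1) * indicator (space M - G) \<omega>)"
    proof (rule integral_mono)
      show "integrable M (\<lambda>\<omega>. T (\<lambda>k. C k \<omega>))"
        unfolding T_def by (rule policy_time_integrable)
      show "integrable M (\<lambda>\<omega>. (1 + e) * R * F + b_max * (\<nu> / \<mu>_min + 1) * indicator (space M - G) \<omega>)"
        using G(1) by (intro Bochner_Integration.integrable_add integrable_mult_right integrable_real_indicator)
          (auto simp: emeasure_eq_measure)
      fix \<omega> assume \<omega>: "\<omega> \<in> space M"
      show "T (\<lambda>k. C k \<omega>) \<le> (1 + e) * R * F + b_max * (\<nu> / \<mu>_min + 1) * indicator (space M - G) \<omega>"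
      proof (cases "\<omega> \<in> G")
        case True
        thus ?thesis using T_good[of "\<lambda>k. C k \<omega>"] G(3) by simp
      next
        case False
        have "0 \<le> (1 + e) * R * F" using e F b_min by simp
        thus ?thesis using T_all[of "\<lambda>k. C k \<omega>"] \<omega> False by simp
      qed
    qed
    also have "\<dots> = (1 + e) * R * F + b_max * (\<nu> / \<mu>_min + 1) * (1 - prob G)"
      using G(1) by (subst Bochner_Integration.integral_add)
        (auto simp: prob_space prob_compl emeasure_eq_measure)
    also have "\<dots> \<le> (1 + 5 * e) * (\<nu> * F) + e * (\<kappa> * (1 / \<mu>_min + 1)) * (\<nu> * F)"
    proof (rule add_mono)
      have "(1 + e) * R \<le> (1 + e) * ((1 + e) * \<nu> + e * \<nu>)"
        using R e e\<nu> by (intro mult_left_mono) auto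
      also have "\<dots> = (1 + 3 * e + 2 * (e * e)) * \<nu>" by (simp add: algebra_simps)
      also have "\<dots> \<le> (1 + 5 * e) * \<nu>"
        using e \<nu> mult_left_le[of e e] by (intro mult_right_mono) auto
      finally have "(1 + e) * R * F \<le> (1 + 5 * e) * \<nu> * F"
        using F b_min by (intro mult_right_mono) auto
      thus "(1 + e) * R * F \<le> (1 + 5 * e) * (\<nu> * F)" by (simp add: mult.assoc)
      have "b_max * (\<nu> / \<mu>_min + 1) * (1 - prob G) \<le> (\<kappa> * b_min) * (\<nu> / \<mu>_min + \<nu>) * e"
        using G(2) \<nu> \<mu>_min_pos b_max prob_le_1[of G] by (intro mult_mono) auto
      also have "\<dots> = e * (\<kappa> * (1 / \<mu>_min + 1)) * (\<nu> * b_min)" by (simp add: algebra_simps)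
      also have "\<dots> \<le> e * (\<kappa> * (1 / \<mu>_min + 1)) * (\<nu> * F)"
        using e \<kappa> \<mu>_min_pos F \<nu> by (intro mult_left_mono mult_nonneg_nonneg) auto
      finally show "b_max * (\<nu> / \<mu>_min + 1) * (1 - prob G) \<le> e * (\<kappa> * (1 / \<mu>_min + 1)) * (\<nu> * F)" .
    qed
    also have "\<dots> = (1 + e * L) * (\<nu> * F)" by (simp add: L_def algebra_simps)
    also have "\<dots> \<le> (1 + \<delta>) * (\<nu> * F)"
      using e \<nu> F b_min by (intro mult_right_mono mult_nonneg_nonneg) auto
    finally show "expectation (\<lambda>\<omega>. \<Sum>n=1..stop_round (\<lambda>n. a (C n \<omega>)). b (C n \<omega>))
        \<le> (1 + \<delta>) * ((\<Sum>c\<in>UNIV. pmf \<mu> c * a c) * (\<Sum>c\<in>UNIV. pmf \<mu> c * b c))"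
      unfolding T_def \<nu>_def F_def .
  qed
qed

text \<open>\<open>S\<close> will be the optimal time. It is at least \<open>V\<close> on the good
  event and nonnegative elsewhere, so passing to expectations costs one factor
  \<open>1 - \<delta>\<close>.\<close>

lemma expectation_lower_bound:
  fixes \<delta> \<kappa> :: real
  assumes \<delta>: "0 < \<delta>" "\<delta> < 1"
  obtains n0 :: real where
    "\<And>n V S. n \<ge> n0 \<Longrightarrow> integrable M S \<Longrightarrow> 0 \<le> V \<Longrightarrow> (\<And>\<omega>. \<omega> \<in> space M \<Longrightarrow> 0 \<le> S \<omega>) \<Longrightarrow>
       (\<And>\<omega>. (\<And>r c. n < real r \<Longrightarrow> r < \<kappa> * n \<Longrightarrow> (1 - \<delta>) * r * pmf \<mu> c \<le> visits (\<lambda>k. C k \<omega>) r c) \<Longrightarrow> V \<le> S \<omega>) \<Longrightarrow>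
       (1 - \<delta>) * V \<le> expectation S"
proof -
  obtain n0 where n0: "\<And>n::real. n \<ge> n0 \<Longrightarrow> \<exists>G\<in>sets M. prob G \<ge> 1 - \<delta> \<and>
     (\<forall>\<omega>\<in>G. \<forall>r::nat. n < r \<longrightarrow> r < \<kappa> * n \<longrightarrow>
        (\<forall>c. visits (\<lambda>k. C k \<omega>) r c \<ge> (1 - \<delta>) * r * pmf \<mu> c))"
    by (rule visits_lower[OF \<delta>, of \<kappa>]) blast
  show thesis
  proof (rule that)
    fix n V :: real and S
    assume n: "n \<ge> n0" and S: "integrable M S" and V: "0 \<le> V" and S_nonneg: "\<And>\<omega>. \<omega> \<in> space M \<Longrightarrow> 0 \<le> S \<omega>"
      and S_ge: "\<And>\<omega>. (\<And>r c. n < real r \<Longrightarrow> r < \<kappa> * n \<Longrightarrow> (1 - \<delta>) * r * pmf \<mu> c \<le> visits (\<lambda>k. C k \<omega>) r c) \<Longrightarrow> V \<le> S \<omega>"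
    obtain G where G: "G \<in> sets M" "prob G \<ge> 1 - \<delta>"
      "\<And>\<omega> r c. \<omega> \<in> G \<Longrightarrow> n < real r \<Longrightarrow> r < \<kappa> * n \<Longrightarrow> (1 - \<delta>) * r * pmf \<mu> c \<le> visits (\<lambda>k. C k \<omega>) r c"
      using n0[OF n] by blast
    have "(1 - \<delta>) * V \<le> prob G * V"
      by (intro mult_right_mono G V)
    also have "\<dots> = expectation (\<lambda>\<omega>. indicator G \<omega> * V)"
      using G(1) by simp
    also have "\<dots> \<le> expectation S"
    proof (rule integral_mono[OF _ S])
      show "integrable M (\<lambda>\<omega>. indicator G \<omega> * V)"
        using G(1) by (intro integrable_mult_left integrable_real_indicator) (auto simp: emeasure_eq_measure)
      fix \<omega> assume "\<omega> \<in> space M"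
      thus "indicator G \<omega> * V \<le> S \<omega>"
        using S_nonneg S_ge G(3) by (cases "\<omega> \<in> G") auto
    qed
    finally show "(1 - \<delta>) * V \<le> expectation S" .
  qed
qed

end

subsection \<open>Norms and coordinatewise monotonicity\<close>

lemma is_norm_convex_on:
  assumes "is_norm N" "convex B"
  shows "convex_on B N"
  unfolding convex_on_def
proof (intro conjI ballI allI impI)
  fix x y and u v :: real assume "0 \<le> u" "0 \<le> v"
  have "N (u *\<^sub>R x + v *\<^sub>R y) \<le> N (u *\<^sub>R x) + N (v *\<^sub>R y)"
    using assms unfolding is_norm_def by blast
  also have "\<dots> = u * N x + v * N y"
    using assms \<open>0 \<le> u\<close> \<open>0 \<le> v\<close> unfolding is_norm_def by simp
  finally show "N (u *\<^sub>R x + v *\<^sub>R y) \<le> u * N x + v * N y" .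
qed fact

lemma is_norm_le_sum:
  fixes N :: "real ^ 'm \<Rightarrow> real"
  assumes "is_norm N"
  shows "N x \<le> (\<Sum>i\<in>UNIV. \<bar>x $ i\<bar> * N (axis i 1))"
proof -
  have tri: "N (x + y) \<le> N x + N y" and hom: "N (a *\<^sub>R x) = \<bar>a\<bar> * N x" and zero: "N 0 = 0" for a x y
    using assms unfolding is_norm_def by blast+
  have "N (\<Sum>i\<in>I. (x $ i) *\<^sub>R axis i 1) \<le> (\<Sum>i\<in>I. \<bar>x $ i\<bar> * N (axis i 1))" if "finite I" for I
    using that
  proof (induction I)
    case (insert i I)
    then show ?case
      using tri[of "(x $ i) *\<^sub>R axis i 1" "\<Sum>i\<in>I. (x $ i) *\<^sub>R axis i 1"] by (simp add: hom)
  qed (simp add: zero)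
  from this[of UNIV] show ?thesis
    by (simp add: basis_expansion scalar_mult_eq_scaleR[symmetric])
qed

text \<open>Half of the equivalence of norms: \<open>N\<close> is Lipschitz for the Euclidean norm,
  so it attains a positive minimum on the unit sphere.\<close>

lemma is_norm_ge:
  fixes N :: "real ^ 'm \<Rightarrow> real"
  assumes N: "is_norm N"
  obtains k where "k > 0" "\<And>x. k * norm x \<le> N x"
proof -
  have tri: "N (x + y) \<le> N x + N y" and hom: "N (a *\<^sub>R x) = \<bar>a\<bar> * N x"
    and nonneg: "0 \<le> N x" and zero: "N x = 0 \<longleftrightarrow> x = 0" for a x y
    using N unfolding is_norm_def by blast+
  define L where "L = (\<Sum>i\<in>UNIV. N (axis i 1))"
  have L: "N x \<le> L * norm x" for x
  proof -
    have "N x \<le> (\<Sum>i\<in>UNIV. \<bar>x $ i\<bar> * N (axis i 1))" by (rule is_norm_le_sum[OF N])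
    also have "\<dots> \<le> (\<Sum>i\<in>UNIV. norm x * N (axis i 1))"
      by (intro sum_mono mult_right_mono nonneg component_le_norm_cart)
    finally show ?thesis by (simp add: L_def sum_distrib_left mult.commute)
  qed
  have "\<bar>N x - N y\<bar> \<le> L * norm (x - y)" for x y
    using tri[of "x - y" y] tri[of "y - x" x] L[of "x - y"] L[of "y - x"]
    by (simp add: norm_minus_commute abs_le_iff)
  hence "L-lipschitz_on (sphere 0 1) N"
    by (intro lipschitz_onI) (auto simp: dist_norm L_def intro: sum_nonneg nonneg)
  hence cont: "continuous_on (sphere 0 1) N"
    by (rule lipschitz_on_continuous_on)
  have "axis undefined 1 \<in> sphere (0 :: real ^ 'm) 1" by simp
  hence "sphere (0 :: real ^ 'm) 1 \<noteq> {}" by blast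
  then obtain z where z: "z \<in> sphere 0 1" "\<And>y. y \<in> sphere 0 1 \<Longrightarrow> N z \<le> N y"
    using continuous_attains_inf[OF compact_sphere _ cont] by auto
  show thesis
  proof (rule that)
    have "z \<noteq> 0" using z(1) by auto
    thus "N z > 0" using nonneg[of z] zero[of z] by linarith
    fix x
    show "N z * norm x \<le> N x"
    proof (cases "x = 0")
      case False
      hence "N z \<le> N ((1 / norm x) *\<^sub>R x)" by (intro z) simp
      also have "\<dots> = N x / norm x" by (simp add: hom)
      finally show ?thesis using False by (simp add: field_simps)
    qed (simp add: nonneg)
  qed
qed

text \<open>Replace the coordinates one at a time; the hybrid points stay in the set because it is a
  product.\<close>

lemma coordinatewise_antimono:
  fixes g :: "real ^ 'm \<Rightarrow> real"
  assumes dec: "\<And>x y i. x \<in> vecs_in S \<Longrightarrow> y \<in> vecs_in S \<Longrightarrow> x $ i \<le> y $ i \<Longrightarrow>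
      (\<forall>j. j \<noteq> i \<longrightarrow> x $ j = y $ j) \<Longrightarrow> g y \<le> g x"
    and x: "x \<in> vecs_in S" and y: "y \<in> vecs_in S" and le: "\<And>i. x $ i \<le> y $ i"
  shows "g y \<le> g x"
proof -
  define z where "z I = (\<chi> i. if i \<in> I then y $ i else x $ i)" for I
  have z_in: "z I \<in> vecs_in S" for I
    using x y by (auto simp: z_def vecs_in_def)
  have "g (z I) \<le> g x" if "finite I" for I
    using that
  proof (induction I)
    case empty
    then show ?case by (simp add: z_def)
  next
    case (insert i I)
    have "g (z (insert i I)) \<le> g (z I)"
      by (rule dec[OF z_in z_in, of _ i]) (auto simp: z_def insert le)
    with insert show ?case by linarith
  qed
  from this[of UNIV] show ?thesis by (simp add: z_def)
qed

subsection \<open>Asymptotic optimality\<close>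

theorem lemma1:
  fixes qmax :: real and \<tau> :: nat
    and d :: "nat \<Rightarrow> real ^ 'm \<Rightarrow> 'c::finite \<Rightarrow> real"
    and reached :: "real \<Rightarrow> (nat \<Rightarrow> real ^ 'm) \<Rightarrow> nat \<Rightarrow> bool"
    and N :: "real ^ 'm \<Rightarrow> real"
    and h :: "real \<Rightarrow> real \<Rightarrow> real"
    and M :: "'w measure" and C :: "nat \<Rightarrow> 'w \<Rightarrow> 'c"
    and K :: "'c \<Rightarrow> 'c pmf" and \<mu> :: "'c pmf"
  assumes qmax_pos: "qmax > 0"
    and d_pos: "\<And>q c. q \<in> vecs_in {0..qmax} \<Longrightarrow> d \<tau> q c > 0"
    and A1_norm: "is_norm N"
    and A1_h: "\<And>\<epsilon>. \<epsilon> > 0 \<Longrightarrow>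
        strict_mono_on {0..qmax} (h \<epsilon>) \<and> continuous_on {0..qmax} (h \<epsilon>) \<and>
        bounded (h \<epsilon> ` {0..qmax}) \<and> (\<forall>x\<in>{0..qmax}. 0 \<le> h \<epsilon> x)"
    and A1_reached: "\<And>\<epsilon> q r. \<epsilon> > 0 \<Longrightarrow> q \<in> param_seqs qmax \<Longrightarrow> r \<ge> 1 \<Longrightarrow>
        reached \<epsilon> q r \<longleftrightarrow> real r > (1 / real r) * (\<Sum>n=1..r. N (vec_apply (h \<epsilon>) (q n)))"
    and A2: "\<And>q. q \<in> param_seqs qmax \<Longrightarrow>
        \<exists>p::real poly. p \<noteq> 0 \<and> poly p 0 = 0 \<and>
          (\<lambda>\<epsilon>. real (min_rounds reached \<epsilon> q)) \<in> \<Theta>[at_right 0](\<lambda>\<epsilon>. 1 / poly p \<epsilon>)"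
    and A3_bounded: "\<And>\<epsilon> c. \<epsilon> > 0 \<Longrightarrow>
        bounded ((\<lambda>x. d \<tau> (vec_apply (inv_into {0..qmax} (h \<epsilon>)) x) c) ` vecs_in (h \<epsilon> ` {0..qmax}))"
    and A3_convex: "\<And>\<epsilon> c. \<epsilon> > 0 \<Longrightarrow>
        convex_on (vecs_in (h \<epsilon> ` {0..qmax}))
          (\<lambda>x. d \<tau> (vec_apply (inv_into {0..qmax} (h \<epsilon>)) x) c)"
    and A3_decreasing: "\<And>\<epsilon> c x y i. \<epsilon> > 0 \<Longrightarrow>
        x \<in> vecs_in (h \<epsilon> ` {0..qmax}) \<Longrightarrow> y \<in> vecs_in (h \<epsilon> ` {0..qmax}) \<Longrightarrow>
        x $ i \<le> y $ i \<Longrightarrow> (\<forall>j. j \<noteq> i \<longrightarrow> x $ j = y $ j) \<Longrightarrow>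
        d \<tau> (vec_apply (inv_into {0..qmax} (h \<epsilon>)) y) c \<le> d \<tau> (vec_apply (inv_into {0..qmax} (h \<epsilon>)) x) c"
    and A4_chain: "stationary_markov_chain M C K \<mu>"
    and A4_irreducible: "irreducible_kernel K"
    and A4_aperiodic: "aperiodic_kernel K"
  shows "\<exists>\<pi> :: real \<Rightarrow> 'c \<Rightarrow> real ^ 'm.
      (\<forall>\<epsilon>>0. \<forall>c. \<pi> \<epsilon> c \<in> vecs_in {0..qmax}) \<and>
      ((\<lambda>\<epsilon>. (\<integral>\<omega>. policy_time reached (d \<tau>) \<epsilon> (\<pi> \<epsilon>) (\<lambda>n. C n \<omega>) \<partial>M) /
             (\<integral>\<omega>. opt_time reached (d \<tau>) qmax \<epsilon> (\<lambda>n. C n \<omega>) \<partial>M)) \<longlongrightarrow> 1) (at_right 0)"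
proof -
  have chain: "markov_chain M C K" and inv: "bind_pmf \<mu> K = \<mu>"
    using A4_chain by (auto simp: stationary_markov_chain_def)
  interpret prob_space M
    using chain by (simp add: markov_chain_def)
  interpret irreducible_chain M C K \<mu>
    by unfold_locales (fact chain inv A4_irreducible)+

  \<comment> \<open>Change of variables and bounds independent of the tolerance\<close>
  define B where "B \<epsilon> = (vecs_in (h \<epsilon> ` {0..qmax}) :: (real ^ 'm) set)" for \<epsilon>
  define H where "H \<epsilon> = (vec_apply (h \<epsilon>) :: real ^ 'm \<Rightarrow> real ^ 'm)" for \<epsilon>
  define Hi where "Hi \<epsilon> = (vec_apply (inv_into {0..qmax} (h \<epsilon>)) :: real ^ 'm \<Rightarrow> real ^ 'm)" for \<epsilon>
  define f where "f \<epsilon> x c = d \<tau> (Hi \<epsilon> x) c" for \<epsilon> x c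
  note A1 = A1_h[THEN conjunct1] A1_h[THEN conjunct2, THEN conjunct1]
    A1_h[THEN conjunct2, THEN conjunct2, THEN conjunct1]
    A1_h[THEN conjunct2, THEN conjunct2, THEN conjunct2, rule_format]

  have inj_h: "inj_on (h \<epsilon>) {0..qmax}" if "\<epsilon> > 0" for \<epsilon>
    using A1(1)[OF that] by (rule strict_mono_on_imp_inj_on)
  have H_B: "H \<epsilon> q \<in> B \<epsilon>" if "q \<in> vecs_in {0..qmax}" for \<epsilon> q
    using that by (auto simp: H_def B_def vecs_in_def vec_apply_def)
  have Hi_H: "Hi \<epsilon> (H \<epsilon> q) = q" if "\<epsilon> > 0" "q \<in> vecs_in {0..qmax}" for \<epsilon> q
    using that inj_h by (simp add: H_def Hi_def vecs_in_def vec_apply_def vec_eq_iff)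
  have Hi_in: "Hi \<epsilon> x \<in> vecs_in {0..qmax}" if "x \<in> B \<epsilon>" for \<epsilon> x
    using that inv_into_into[of _ "h \<epsilon>" "{0..qmax}"] unfolding Hi_def B_def vecs_in_def vec_apply_def
    by (simp del: atLeastAtMost_iff)
  have H_Hi: "H \<epsilon> (Hi \<epsilon> x) = x" if "x \<in> B \<epsilon>" for \<epsilon> x
    using that by (simp add: H_def Hi_def B_def vecs_in_def vec_apply_def vec_eq_iff f_inv_into_f)
  have f_H: "f \<epsilon> (H \<epsilon> q) c = d \<tau> q c" if "\<epsilon> > 0" "q \<in> vecs_in {0..qmax}" for \<epsilon> q c
    using Hi_H[OF that] by (simp add: f_def)

  \<comment> \<open>Durations decrease in \<open>h(q)\<close> and \<open>h\<close> increases, so the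
    shortest ones occur at the top corner of the cube. Since \<open>d\<close> does not involve
    \<open>\<epsilon>\<close>, any single tolerance may be used to see this; here it is 1, as for
    the upper bound below.\<close>
  define qm :: "real ^ 'm" where "qm = (\<chi> i. qmax)"
  have qm: "qm \<in> vecs_in {0..qmax}"
    using qmax_pos by (simp add: qm_def vecs_in_def)
  have d_ge: "d \<tau> qm c \<le> d \<tau> q c" if q: "q \<in> vecs_in {0..qmax}" for q c
  proof -
    have "f 1 (H 1 qm) c \<le> f 1 (H 1 q) c"
    proof (rule coordinatewise_antimono[where g = "\<lambda>x. f 1 x c" and S = "h 1 ` {0..qmax}"])
      show "H 1 q \<in> vecs_in (h 1 ` {0..qmax})" "H 1 qm \<in> vecs_in (h 1 ` {0..qmax})"
        using H_B[OF q, of 1] H_B[OF qm, of 1] by (simp_all add: B_def)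
      show "H 1 q $ i \<le> H 1 qm $ i" for i
        using strict_mono_on_leD[OF A1(1)[of 1], of "q $ i" qmax] q qmax_pos
        by (simp add: H_def vec_apply_def qm_def vecs_in_def)
    qed (use A3_decreasing[of 1] in \<open>auto simp: f_def Hi_def\<close>)
    thus ?thesis using f_H[of 1] q qm by simp
  qed
  define f_min where "f_min = Min (range (d \<tau> qm))"
  have f_min_pos: "f_min > 0"
    unfolding f_min_def using d_pos[OF qm] by (subst Min_gr_iff) auto
  have f_min: "f_min \<le> d \<tau> q c" if "q \<in> vecs_in {0..qmax}" for q c
    unfolding f_min_def by (rule order.trans[OF Min_le d_ge[OF that]]) auto
  have "\<exists>b. \<forall>q\<in>vecs_in {0..qmax}. d \<tau> q c \<le> b" for c
  proof -
    obtain b where b: "\<And>x. x \<in> B 1 \<Longrightarrow> \<bar>f 1 x c\<bar> \<le> b"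
      using A3_bounded[of 1 c] by (auto simp: bounded_iff f_def Hi_def B_def)
    have "d \<tau> q c \<le> b" if "q \<in> vecs_in {0..qmax}" for q
      using b[OF H_B[OF that, of 1]] f_H[of 1 q c] that by simp
    thus ?thesis by blast
  qed
  then obtain b where b: "\<And>q c. q \<in> vecs_in {0..qmax} \<Longrightarrow> d \<tau> q c \<le> b c"
    by metis
  define f_max where "f_max = Max (range b)"
  have f_max: "d \<tau> q c \<le> f_max" if "q \<in> vecs_in {0..qmax}" for q c
    unfolding f_max_def by (rule order.trans[OF b[OF that] Max_ge]) auto

  have N_nonneg: "0 \<le> N x" for x
    using A1_norm by (simp add: is_norm_def)
  have "\<exists>b. \<forall>x\<in>B \<epsilon>. N x \<le> b" if \<epsilon>: "\<epsilon> > 0" for \<epsilon>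
  proof -
    obtain u where u: "\<And>t. t \<in> {0..qmax} \<Longrightarrow> \<bar>h \<epsilon> t\<bar> \<le> u"
      using A1(3)[OF \<epsilon>] by (auto simp: bounded_iff simp del: atLeastAtMost_iff)
    have "N x \<le> (\<Sum>i\<in>UNIV. u * N (axis i 1))" if "x \<in> B \<epsilon>" for x
    proof (rule order.trans[OF is_norm_le_sum[OF A1_norm]], intro sum_mono mult_right_mono N_nonneg)
      fix i
      have "x $ i \<in> h \<epsilon> ` {0..qmax}" using that by (simp add: B_def vecs_in_def)
      thus "\<bar>x $ i\<bar> \<le> u" using u by (auto simp del: atLeastAtMost_iff)
    qed
    thus ?thesis by blast
  qed
  then obtain N_max where N_max: "\<And>\<epsilon> x. \<epsilon> > 0 \<Longrightarrow> x \<in> B \<epsilon> \<Longrightarrow> N x \<le> N_max \<epsilon>"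
    by metis

  have alloc: "allocation (B \<epsilon>) N (f \<epsilon>) (pmf \<mu>) f_min f_max (N_max \<epsilon>)" if \<epsilon>: "\<epsilon> > 0" for \<epsilon>
  proof
    show "B \<epsilon> \<noteq> {}" using H_B[OF qm, of \<epsilon>] by auto
    show f_conv: "convex_on (B \<epsilon>) (\<lambda>x. f \<epsilon> x c)" for c
      using A3_convex[OF \<epsilon>] by (simp add: f_def B_def Hi_def)
    \<comment> \<open>Convexity of the domain \<open>B \<epsilon>\<close> is read off from the
      convexity of the duration, which includes it.\<close>
    show "convex_on (B \<epsilon>) N"
      using f_conv[of undefined] by (intro is_norm_convex_on A1_norm) (simp add: convex_on_def)
  qed (use f_min_pos f_min f_max Hi_in N_nonneg N_max \<epsilon> \<mu>_pos sum_pmf_UNIV in \<open>auto simp: f_def\<close>)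

  \<comment> \<open>Near-optimal stationary policies\<close>
  define V where "V \<epsilon> = allocation.opt_value (B \<epsilon>) N (f \<epsilon>) (pmf \<mu>)" for \<epsilon>
  define N_min where "N_min \<epsilon> = allocation.N_min (B \<epsilon>) N" for \<epsilon>
  define m_N where "m_N y = (\<Sum>c\<in>UNIV. pmf \<mu> c * N (y c))" for y
  define m_f where "m_f \<epsilon> y = (\<Sum>c\<in>UNIV. pmf \<mu> c * f \<epsilon> (y c) c)" for \<epsilon> y

  have "\<exists>y. (\<forall>c. y c \<in> B \<epsilon>) \<and> m_N y * m_f \<epsilon> y < V \<epsilon> + \<epsilon>" if \<epsilon>: "\<epsilon> > 0" for \<epsilon>
  proof -
    interpret allocation "B \<epsilon>" N "f \<epsilon>" "pmf \<mu>" f_min f_max "N_max \<epsilon>"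
      by (rule alloc[OF \<epsilon>])
    have "opt_value < V \<epsilon> + \<epsilon>" using \<epsilon> by (simp add: V_def)
    then obtain y where "\<And>c. y c \<in> B \<epsilon>" "mean_N y * mean_f y < V \<epsilon> + \<epsilon>"
      by (rule near_optimal_policy) blast
    thus ?thesis
      unfolding m_N_def m_f_def mean_N_def mean_f_def by blast
  qed
  then obtain Y where Y: "\<And>\<epsilon> c. \<epsilon> > 0 \<Longrightarrow> Y \<epsilon> c \<in> B \<epsilon>"
    "\<And>\<epsilon>. \<epsilon> > 0 \<Longrightarrow> m_N (Y \<epsilon>) * m_f \<epsilon> (Y \<epsilon>) < V \<epsilon> + \<epsilon>"
    by metis
  define \<pi> where "\<pi> \<epsilon> c = Hi \<epsilon> (Y \<epsilon> c)" for \<epsilon> c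
  have \<pi>: "\<pi> \<epsilon> c \<in> vecs_in {0..qmax}" if "\<epsilon> > 0" for \<epsilon> c
    using Hi_in Y that by (simp add: \<pi>_def)

  \<comment> \<open>The random times and their integrability\<close>
  have rounds: "min_rounds reached \<epsilon> q = stop_round (\<lambda>n. N (H \<epsilon> (q n)))"
    if "\<epsilon> > 0" "q \<in> param_seqs qmax" for \<epsilon> q
    unfolding min_rounds_def stop_round_def H_def
    by (intro arg_cong[where f = Least] ext) (use A1_reached[OF that] in blast)
  have param: "q n \<in> vecs_in {0..qmax}" if "q \<in> param_seqs qmax" "n \<ge> 1" for q n
    using that by (simp add: param_seqs_def)
  have rounds_le: "min_rounds reached \<epsilon> q \<le> nat \<lfloor>N_max \<epsilon>\<rfloor> + 1"
    if "\<epsilon> > 0" "q \<in> param_seqs qmax" for \<epsilon> q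
    unfolding rounds[OF that] by (rule stop_round_le_bound) (intro N_max H_B param that)
  define P where "P \<epsilon> s = policy_time reached (d \<tau>) \<epsilon> (\<pi> \<epsilon>) s" for \<epsilon> s
  define Q where "Q \<epsilon> s = opt_time reached (d \<tau>) qmax \<epsilon> s" for \<epsilon> s
  have P_eq: "P \<epsilon> s = (\<Sum>n=1..stop_round (\<lambda>n. N (Y \<epsilon> (s n))). f \<epsilon> (Y \<epsilon> (s n)) (s n))"
    if \<epsilon>: "\<epsilon> > 0" for \<epsilon> s
  proof -
    have "(\<lambda>n. \<pi> \<epsilon> (s n)) \<in> param_seqs qmax"
      using \<pi>[OF \<epsilon>] by (simp add: param_seqs_def)
    thus ?thesis
      by (simp add: P_def policy_time_def wall_clock_def rounds[OF \<epsilon>] \<pi>_def H_Hi[OF Y(1)[OF \<epsilon>]] f_def)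
  qed
  have wall_nonneg: "0 \<le> wall_clock reached (d \<tau>) \<epsilon> q s" if "q \<in> param_seqs qmax" for \<epsilon> q s
    unfolding wall_clock_def using param[OF that] d_pos by (intro sum_nonneg) (auto intro: less_imp_le)
  have "(\<lambda>_. qm) \<in> param_seqs qmax"
    using qm by (simp add: param_seqs_def)
  hence ps_ne: "(param_seqs qmax :: (nat \<Rightarrow> real ^ 'm) set) \<noteq> {}"
    by auto
  have Q_nonneg: "0 \<le> Q \<epsilon> s" for \<epsilon> s
    unfolding Q_def opt_time_def by (rule cINF_greatest[OF ps_ne wall_nonneg])
  have Q_le_P: "Q \<epsilon> s \<le> P \<epsilon> s" if "\<epsilon> > 0" for \<epsilon> s
    unfolding P_def Q_def opt_time_def policy_time_def
  proof (rule cINF_lower)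
    show "(\<lambda>n. \<pi> \<epsilon> (s n)) \<in> param_seqs qmax"
      using \<pi>[OF that] by (simp add: param_seqs_def)
  qed (auto intro!: bdd_belowI2[of _ 0] wall_nonneg)
  \<comment> \<open>Although the infimum ranges over uncountably many schedules, all of them stop
    within \<open>nat \<lfloor>N_max \<epsilon>\<rfloor> + 1\<close> rounds, so it depends on that
    prefix of the states only.\<close>
  have Q_int: "integrable M (\<lambda>\<omega>. Q \<epsilon> (\<lambda>n. C n \<omega>))" if \<epsilon>: "\<epsilon> > 0" for \<epsilon>
  proof (rule path_integrable[of "nat \<lfloor>N_max \<epsilon>\<rfloor> + 1" "Q \<epsilon>"])
    fix s t assume st: "\<forall>k\<in>{1..nat \<lfloor>N_max \<epsilon>\<rfloor> + 1}. s k = (t k :: 'c)"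
    show "Q \<epsilon> s = Q \<epsilon> t"
      unfolding Q_def opt_time_def wall_clock_def
    proof (intro INF_cong refl sum.cong)
      fix q n assume "q \<in> param_seqs qmax" "n \<in> {1..min_rounds reached \<epsilon> q}"
      hence "n \<in> {1..nat \<lfloor>N_max \<epsilon>\<rfloor> + 1}" using rounds_le[OF \<epsilon>, of q] by auto
      thus "d \<tau> (q n) (s n) = d \<tau> (q n) (t n)" using st by simp
    qed
  qed
  have P_int: "integrable M (\<lambda>\<omega>. P \<epsilon> (\<lambda>n. C n \<omega>))" if \<epsilon>: "\<epsilon> > 0" for \<epsilon>
    unfolding P_eq[OF \<epsilon>]
    by (rule policy_time_integrable[where a = "\<lambda>c. N (Y \<epsilon> c)" and b = "\<lambda>c. f \<epsilon> (Y \<epsilon> c) c"])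

  \<comment> \<open>Divergence of the minimal number of rounds\<close>
  obtain k where k: "k > 0" "\<And>x. k * norm x \<le> N x"
    by (rule is_norm_ge[OF A1_norm]) blast
  \<comment> \<open>\<open>N\<close> need not be monotone in the coordinates, so it is compared with
    the Euclidean norm, which dominates any one coordinate and thus
    \<open>h \<epsilon> 0\<close>.\<close>
  have N_min_ge: "k * h \<epsilon> 0 \<le> N_min \<epsilon>" if \<epsilon>: "\<epsilon> > 0" for \<epsilon>
    unfolding N_min_def
  proof (rule allocation.N_min_ge[OF alloc[OF \<epsilon>]])
    fix x assume x: "x \<in> B \<epsilon>"
    hence "x $ undefined \<in> h \<epsilon> ` {0..qmax}" by (simp add: B_def vecs_in_def)
    then obtain t where t: "t \<in> {0..qmax}" "x $ undefined = h \<epsilon> t" by blast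
    have "h \<epsilon> 0 \<le> h \<epsilon> t"
      using t by (intro strict_mono_on_leD[OF A1(1)[OF \<epsilon>]]) auto
    also have "\<dots> \<le> norm x"
      using component_le_norm_cart[of x undefined] t by simp
    finally have "k * h \<epsilon> 0 \<le> k * norm x" using k by simp
    also have "\<dots> \<le> N x" by (rule k)
    finally show "k * h \<epsilon> 0 \<le> N x" .
  qed
  have pos_ev: "eventually (\<lambda>\<epsilon>::real. \<epsilon> > 0) (at_right 0)"
    by (rule eventually_at_right_less)
  have N_min_top: "filterlim N_min at_top (at_right 0)"
  proof -
    define q0 :: "nat \<Rightarrow> real ^ 'm" where "q0 = (\<lambda>_. 0)"
    define one :: "real ^ 'm" where "one = (\<chi> i. 1)"
    have q0: "q0 \<in> param_seqs qmax"
      using qmax_pos by (simp add: q0_def param_seqs_def vecs_in_def)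
    obtain p :: "real poly" where p: "p \<noteq> 0" "poly p 0 = 0"
      "(\<lambda>\<epsilon>. real (min_rounds reached \<epsilon> q0)) \<in> \<Theta>[at_right 0](\<lambda>\<epsilon>. 1 / poly p \<epsilon>)"
      using A2[OF q0] by blast
    have "((\<lambda>\<epsilon>. poly p \<epsilon>) \<longlongrightarrow> poly p 0) (at_right 0)"
      by (intro tendsto_intros)
    moreover have "eventually (\<lambda>\<epsilon>. poly p \<epsilon> \<noteq> 0) (at_right 0)"
    proof (rule filter_leD[OF at_le])
      show "eventually (\<lambda>\<epsilon>. poly p \<epsilon> \<noteq> 0) (at 0)"
        using islimpt_finite[OF poly_roots_finite[OF p(1)], of 0] by (simp add: islimpt_iff_eventually)
    qed simp
    ultimately have "filterlim (\<lambda>\<epsilon>. poly p \<epsilon>) (at 0) (at_right 0)"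
      using p(2) by (simp add: filterlim_at)
    hence "filterlim (\<lambda>\<epsilon>. 1 / poly p \<epsilon>) at_infinity (at_right 0)"
      by (intro filterlim_divide_at_infinity[OF tendsto_const]) auto
    \<comment> \<open>The sign of \<open>p\<close> near 0 is unknown, but the asymptotic bound sees
      absolute values only.\<close>
    hence inf: "filterlim (\<lambda>\<epsilon>. norm (1 / poly p \<epsilon>)) at_top (at_right 0)"
      by (rule filterlim_at_infinity_imp_norm_at_top)
    obtain c where c: "c > 0"
      "eventually (\<lambda>\<epsilon>. norm (real (min_rounds reached \<epsilon> q0)) \<ge> c * norm (1 / poly p \<epsilon>)) (at_right 0)"
      using p(3) unfolding bigtheta_def by (auto elim!: landau_omega.bigE)
    have N_one: "N one > 0"
    proof -
      have "one \<noteq> 0" by (simp add: one_def vec_eq_iff)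
      hence "k * norm one > 0" using k by simp
      thus ?thesis using k(2)[of one] by linarith
    qed
    \<comment> \<open>At zero parameters the criterion compares \<open>r\<close> with the constant
      \<open>h \<epsilon> 0 * N one\<close>, so many rounds force \<open>h \<epsilon> 0\<close> to
      be large.\<close>
    have h_ge: "(real (min_rounds reached \<epsilon> q0) - 1) / N one \<le> h \<epsilon> 0" if \<epsilon>: "\<epsilon> > 0" for \<epsilon>
    proof -
      have h0: "0 \<le> h \<epsilon> 0" using A1(4)[OF \<epsilon>] qmax_pos by simp
      have "H \<epsilon> 0 = h \<epsilon> 0 *\<^sub>R one"
        by (simp add: H_def vec_apply_def one_def vec_eq_iff)
      hence "N (H \<epsilon> 0) = h \<epsilon> 0 * N one"
        using A1_norm h0 by (simp add: is_norm_def)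
      hence "min_rounds reached \<epsilon> q0 \<le> nat \<lfloor>h \<epsilon> 0 * N one\<rfloor> + 1"
        unfolding rounds[OF \<epsilon> q0] by (intro stop_round_le_bound) (simp add: q0_def)
      moreover have "0 \<le> h \<epsilon> 0 * N one" using h0 N_one by simp
      ultimately have "real (min_rounds reached \<epsilon> q0) \<le> h \<epsilon> 0 * N one + 1" by linarith
      thus ?thesis using N_one by (simp add: field_simps)
    qed
    have "filterlim (\<lambda>\<epsilon>. - 1 + c * norm (1 / poly p \<epsilon>)) at_top (at_right 0)"
      by (intro filterlim_tendsto_add_at_top[OF tendsto_const]
          filterlim_tendsto_pos_mult_at_top[OF tendsto_const c(1) inf])
    hence "filterlim (\<lambda>\<epsilon>. (k / N one) * (- 1 + c * norm (1 / poly p \<epsilon>))) at_top (at_right 0)"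
      using k N_one by (intro filterlim_tendsto_pos_mult_at_top[OF tendsto_const]) auto
    moreover have "eventually (\<lambda>\<epsilon>. (k / N one) * (- 1 + c * norm (1 / poly p \<epsilon>)) \<le> N_min \<epsilon>) (at_right 0)"
      using c(2) pos_ev
    proof eventually_elim
      case (elim \<epsilon>)
      have "(k / N one) * (- 1 + c * norm (1 / poly p \<epsilon>)) \<le> (k / N one) * (real (min_rounds reached \<epsilon> q0) - 1)"
        using elim k N_one by (intro mult_left_mono) auto
      also have "\<dots> = k * ((real (min_rounds reached \<epsilon> q0) - 1) / N one)" by simp
      also have "\<dots> \<le> k * h \<epsilon> 0"
        using h_ge[OF elim(2)] k by (intro mult_left_mono) auto
      also have "\<dots> \<le> N_min \<epsilon>" by (rule N_min_ge[OF elim(2)])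
      finally show ?case .
    qed
    ultimately show ?thesis by (rule filterlim_at_top_mono)
  qed

  \<comment> \<open>Numerator: one factor from the random fluctuations, one from the slack of the
    policy. Denominator: two from the pathwise bound, one from the probability of the good
    event.\<close>
  have bounds: "eventually (\<lambda>\<epsilon>. 1 \<le> expectation (\<lambda>\<omega>. P \<epsilon> (\<lambda>n. C n \<omega>)) / expectation (\<lambda>\<omega>. Q \<epsilon> (\<lambda>n. C n \<omega>)) \<and>
      expectation (\<lambda>\<omega>. P \<epsilon> (\<lambda>n. C n \<omega>)) / expectation (\<lambda>\<omega>. Q \<epsilon> (\<lambda>n. C n \<omega>)) \<le> (1 + \<delta>)\<^sup>2 / (1 - \<delta>) ^ 3) (at_right 0)"
    if \<delta>: "0 < \<delta>" "\<delta> < 1" for \<delta>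
  proof -
    obtain n1 :: real where n1: "\<And>a b. (\<And>c. 0 \<le> a c) \<Longrightarrow> (\<And>c. f_min \<le> b c) \<Longrightarrow> (\<And>c. b c \<le> f_max) \<Longrightarrow>
       n1 \<le> (\<Sum>c\<in>UNIV. pmf \<mu> c * a c) \<Longrightarrow>
       expectation (\<lambda>\<omega>. \<Sum>n=1..stop_round (\<lambda>n. a (C n \<omega>)). b (C n \<omega>))
         \<le> (1 + \<delta>) * ((\<Sum>c\<in>UNIV. pmf \<mu> c * a c) * (\<Sum>c\<in>UNIV. pmf \<mu> c * b c))"
      by (rule policy_time_upper_bound[OF f_min_pos \<delta>(1), of f_max]) blast
    obtain n2 :: real where n2: "\<And>n V S. n \<ge> n2 \<Longrightarrow> integrable M S \<Longrightarrow> 0 \<le> V \<Longrightarrow>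
       (\<And>\<omega>. \<omega> \<in> space M \<Longrightarrow> 0 \<le> S \<omega>) \<Longrightarrow>
       (\<And>\<omega>. (\<And>r c. n < real r \<Longrightarrow> r < (f_max / f_min) * n \<Longrightarrow>
          (1 - \<delta>) * r * pmf \<mu> c \<le> visits (\<lambda>k. C k \<omega>) r c) \<Longrightarrow> V \<le> S \<omega>) \<Longrightarrow>
       (1 - \<delta>) * V \<le> expectation S"
      by (rule expectation_lower_bound[OF \<delta>, of "f_max / f_min"]) blast
    have "eventually (\<lambda>\<epsilon>. \<epsilon> \<le> \<delta>) (at_right 0)"
      using eventually_at_right_real[OF \<delta>(1)] by eventually_elim auto
    moreover have "eventually (\<lambda>\<epsilon>. max (1 / f_min) (max n1 n2) \<le> N_min \<epsilon>) (at_right 0)"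
      using N_min_top unfolding filterlim_at_top by blast
    ultimately show ?thesis
      using pos_ev
    proof eventually_elim
      case (elim \<epsilon>)
      note \<epsilon> = elim(3)
      interpret al: allocation "B \<epsilon>" N "f \<epsilon>" "pmf \<mu>" f_min f_max "N_max \<epsilon>"
        by (rule alloc[OF \<epsilon>])
      have "1 \<le> N_min \<epsilon> * f_min"
        using elim(2) f_min_pos by (simp add: field_simps)
      also have "\<dots> \<le> V \<epsilon>"
        unfolding N_min_def V_def by (rule al.opt_value_ge)
      finally have V: "1 \<le> V \<epsilon>" .
      define EP where "EP = expectation (\<lambda>\<omega>. P \<epsilon> (\<lambda>n. C n \<omega>))"
      define EQ where "EQ = expectation (\<lambda>\<omega>. Q \<epsilon> (\<lambda>n. C n \<omega>))"
      have "EP \<le> (1 + \<delta>) * (m_N (Y \<epsilon>) * m_f \<epsilon> (Y \<epsilon>))"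
        unfolding EP_def P_eq[OF \<epsilon>] m_N_def m_f_def
      proof (rule n1)
        show "n1 \<le> (\<Sum>c\<in>UNIV. pmf \<mu> c * N (Y \<epsilon> c))"
          using al.mean_N_ge[of "Y \<epsilon>", OF Y(1)[OF \<epsilon>]] elim(2)
          by (simp add: al.mean_N_def N_min_def)
      qed (use N_nonneg al.f_bounds Y(1)[OF \<epsilon>] in auto)
      also have "\<dots> \<le> (1 + \<delta>) * ((1 + \<delta>) * V \<epsilon>)"
      proof (intro mult_left_mono)
        have "m_N (Y \<epsilon>) * m_f \<epsilon> (Y \<epsilon>) \<le> V \<epsilon> + \<epsilon>"
          using Y(2)[OF \<epsilon>] by simp
        also have "\<dots> \<le> V \<epsilon> + \<delta> * V \<epsilon>"
          using elim(1) V \<delta> mult_left_mono[of 1 "V \<epsilon>" \<delta>] by linarith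
        finally show "m_N (Y \<epsilon>) * m_f \<epsilon> (Y \<epsilon>) \<le> (1 + \<delta>) * V \<epsilon>"
          by (simp add: algebra_simps)
      qed (use \<delta> in auto)
      finally have EP: "EP \<le> (1 + \<delta>)\<^sup>2 * V \<epsilon>"
        by (simp add: power2_eq_square mult.assoc)
      have "(1 - \<delta>) * ((1 - \<delta>)\<^sup>2 * V \<epsilon>) \<le> EQ"
        unfolding EQ_def
      proof (rule n2[of "N_min \<epsilon>"])
        fix \<omega>
        assume vis: "\<And>r c. N_min \<epsilon> < real r \<Longrightarrow> r < (f_max / f_min) * N_min \<epsilon> \<Longrightarrow>
          (1 - \<delta>) * r * pmf \<mu> c \<le> visits (\<lambda>k. C k \<omega>) r c"
        show "(1 - \<delta>)\<^sup>2 * V \<epsilon> \<le> Q \<epsilon> (\<lambda>n. C n \<omega>)"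
          unfolding Q_def opt_time_def
        proof (rule cINF_greatest[OF ps_ne])
          fix q :: "nat \<Rightarrow> real ^ 'm" assume q: "q \<in> param_seqs qmax"
          have "(1 - \<delta>)\<^sup>2 * V \<epsilon> \<le> (\<Sum>n=1..stop_round (\<lambda>n. N (H \<epsilon> (q n))). f \<epsilon> (H \<epsilon> (q n)) (C n \<omega>))"
            unfolding V_def using \<delta> vis H_B param[OF q]
            by (intro al.stopped_schedule_lower_bound) (auto simp: N_min_def)
          also have "\<dots> = wall_clock reached (d \<tau>) \<epsilon> q (\<lambda>n. C n \<omega>)"
            unfolding wall_clock_def rounds[OF \<epsilon> q]
            by (intro sum.cong refl f_H \<epsilon> param[OF q]) auto
          finally show "(1 - \<delta>)\<^sup>2 * V \<epsilon> \<le> wall_clock reached (d \<tau>) \<epsilon> q (\<lambda>n. C n \<omega>)" .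
        qed
      qed (use elim(2) Q_int[OF \<epsilon>] V Q_nonneg in auto)
      hence EQ: "(1 - \<delta>) ^ 3 * V \<epsilon> \<le> EQ"
        by (simp add: power2_eq_square power3_eq_cube mult.assoc)
      have pos: "0 < (1 - \<delta>) ^ 3 * V \<epsilon>" using \<delta> V by simp
      \<comment> \<open>For each realization the policy produces one of the schedules competing in
        the infimum.\<close>
      have "EQ \<le> EP"
        unfolding EP_def EQ_def by (intro integral_mono Q_int P_int Q_le_P \<epsilon>)
      hence "1 \<le> EP / EQ" using EQ pos by simp
      moreover have "EP / EQ \<le> ((1 + \<delta>)\<^sup>2 * V \<epsilon>) / ((1 - \<delta>) ^ 3 * V \<epsilon>)"
        using EP EQ pos V by (intro frac_le) auto
      ultimately show ?case using V by (simp add: EP_def EQ_def)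
    qed
  qed

  have "((\<lambda>\<epsilon>. expectation (\<lambda>\<omega>. P \<epsilon> (\<lambda>n. C n \<omega>)) / expectation (\<lambda>\<omega>. Q \<epsilon> (\<lambda>n. C n \<omega>))) \<longlongrightarrow> 1) (at_right 0)"
  proof (rule tendstoI)
    fix e :: real assume e: "e > 0"
    \<comment> \<open>\<open>\<delta>\<close> is fixed first, depending on \<open>e\<close> alone;
      only then does \<open>\<epsilon>\<close> tend to 0.\<close>
    have "((\<lambda>\<delta>::real. (1 + \<delta>)\<^sup>2 / (1 - \<delta>) ^ 3) \<longlongrightarrow> (1 + 0)\<^sup>2 / (1 - 0) ^ 3) (at_right 0)"
      by (intro tendsto_intros) auto
    hence "eventually (\<lambda>\<delta>::real. (1 + \<delta>)\<^sup>2 / (1 - \<delta>) ^ 3 < 1 + e) (at_right 0)"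
      using e by (intro order_tendstoD(2)) auto
    moreover have "eventually (\<lambda>\<delta>::real. \<delta> \<in> {0<..<1}) (at_right 0)"
      by (rule eventually_at_right_real) simp
    ultimately have "eventually (\<lambda>\<delta>::real. (1 + \<delta>)\<^sup>2 / (1 - \<delta>) ^ 3 < 1 + e \<and> \<delta> \<in> {0<..<1}) (at_right 0)"
      by (rule eventually_conj)
    then obtain \<delta> :: real where "(1 + \<delta>)\<^sup>2 / (1 - \<delta>) ^ 3 < 1 + e" "0 < \<delta>" "\<delta> < 1"
      using eventually_happens'[OF trivial_limit_at_right_real] by fastforce
    with bounds[of \<delta>]
    show "eventually (\<lambda>\<epsilon>. dist (expectation (\<lambda>\<omega>. P \<epsilon> (\<lambda>n. C n \<omega>)) / expectation (\<lambda>\<omega>. Q \<epsilon> (\<lambda>n. C n \<omega>))) 1 < e) (at_right 0)"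
      by (auto simp: dist_real_def elim!: eventually_mono)
  qed
  thus ?thesis
    using \<pi> unfolding P_def Q_def by blast
qed

end
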